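(* Let $g_n$, $n\in\mathbb{N}$, and $g$ be entire maps of finite type having the same number of singular values. Let $\gamma\subset\mathbb{C}\setminus S_g$ be a simple closed curve and $\widetilde\gamma$ a connected component of $g^{-1}(\gamma)$. Suppose that $(g_n)$ converges locally uniformly on $\mathbb{C}$ to $g$. Then for any $z\in\widetilde\gamma$ there exists $\varepsilon_{z,\gamma}>0$ such that for all $n$ sufficiently large there is a unique connected component $\widetilde\gamma_n$ of $g_n^{-1}(\gamma)$ satisfying $d(z,\widetilde\gamma_n)<\varepsilon_{z,\gamma}$. Moreover: 1. if the degree of the covering $g|\widetilde\gamma\colon\widetilde\gamma\to\gamma$ is finite, then for all $n$ large enough $\widetilde\gamma_n$ is a simple closed curve and $\deg(g_n|\widetilde\gamma_n)=\deg(g|\widetilde\gamma)$, and for every $\varepsilon>0$ there exists $N=N(\varepsilon)$ such that $\widetilde\gamma_n\subset U_\varepsilon(\widetilde\gamma)$ for all $n\ge N$; 2. if the degree of the covering $g|\widetilde\gamma$ is infinite (i.e. $\widetilde\gamma$ is an unbounded curve), then $\deg(g_n|\widetilde\gamma_n)\to\infty$ as $n\to\infty$.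
   Context: For a non-constant entire map $g\colon\mathbb{C}\to\mathbb{C}$, a point $y\in\mathbb{C}$ is a regular value if it has a neighbourhood $U$ such that $g^{-1}(U)$ is a disjoint union of open sets each mapped homeomorphically onto $U$ by $g$; otherwise $y$ is a singular value. $S_g$ denotes the set of singular values, and $g$ is of finite type if it is non-constant and $S_g$ is finite. A simple closed curve is the image of a simple loop. $d(z,X)$ is the Euclidean distance from $z$ to $X\subset\mathbb{C}$, and $U_\varepsilon(X):=\{z\in\mathbb{C}: d(z,X)<\varepsilon\}$. *)

theory Defs
  imports "HOL-Complex_Analysis.Complex_Analysis"
begin

definition regular_value :: "(complex \<Rightarrow> complex) \<Rightarrow> complex \<Rightarrow> bool" where
  "regular_value g y \<longleftrightarrow>
     (\<exists>U. open U \<and> y \<in> U \<and>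
        (\<exists>\<V>. \<Union>\<V> = g -` U \<and> pairwise disjnt \<V> \<and>
             (\<forall>V\<in>\<V>. open V \<and> (\<exists>h. homeomorphism V U g h))))"

definition singular_values :: "(complex \<Rightarrow> complex) \<Rightarrow> complex set" where
  "singular_values g = {y. \<not> regular_value g y}"

definition entire_of_finite_type :: "(complex \<Rightarrow> complex) \<Rightarrow> bool" where
  "entire_of_finite_type g \<longleftrightarrow>
     g holomorphic_on UNIV \<and> \<not> g constant_on UNIV \<and> finite (singular_values g)"

definition simple_closed_curve :: "complex set \<Rightarrow> bool" where
  "simple_closed_curve C \<longleftrightarrow>
     (\<exists>c. simple_path c \<and> pathfinish c = pathstart c \<and> C = path_image c)"

definition converges_locally_uniformly ::
  "(nat \<Rightarrow> complex \<Rightarrow> complex) \<Rightarrow> (complex \<Rightarrow> complex) \<Rightarrow> bool" where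
  "converges_locally_uniformly gs g \<longleftrightarrow>
     (\<forall>z. \<exists>U. open U \<and> z \<in> U \<and> uniform_limit U gs g sequentially)"

definition ecard :: "'a set \<Rightarrow> enat" where
  "ecard A = (if finite A then enat (card A) else \<infinity>)"

(* The common cardinality of the fibres of p : T \<rightarrow> S. It carries information only if this
   cardinality is constant on S, e.g. for a covering of a connected non-empty S. The argument
   order is that of covering_space. *)
definition covering_degree :: "'a set \<Rightarrow> ('a \<Rightarrow> 'b) \<Rightarrow> 'b set \<Rightarrow> enat" where
  "covering_degree T p S = (THE d. \<forall>y\<in>S. ecard (T \<inter> p -` {y}) = d)"

end

theory Submission
  imports Defs
begin

text \<open>
  A disc \<open>D\<close> free of singular values of infinitely many \<open>g\<^sub>n\<close> is free of singular values of \<open>g\<close>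
  near its centre: the inverse branches of \<open>g\<^sub>n\<close> on \<open>D\<close> omit two fixed values, so by Montel they
  converge to inverse branches of \<open>g\<close>. Hence each singular value of \<open>g\<close> attracts a singular value of
  \<open>g\<^sub>n\<close>, and since the numbers agree, \<open>\<gamma>\<close> eventually avoids the singular values of \<open>g\<^sub>n\<close>.

  Let \<open>p : \<real> \<rightarrow> \<gamma>\<close> be a parametrization of period \<open>1\<close>. The components of \<open>g\<^sup>-\<^sup>1(\<gamma>)\<close> are the ranges of
  the lifts \<open>q\<close> of \<open>p\<close>, and the degree is the least \<open>d > 0\<close> with \<open>q(d) = q(0)\<close>, or \<open>\<infinity>\<close> if there is
  none. A lift of \<open>p\<close> through \<open>g\<^sub>n\<close> that is close to \<open>q\<close> at one time stays close to \<open>q\<close> on a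
  prescribed compact interval, so it has the same least period if \<open>q\<close> is periodic, and no small
  period if \<open>q\<close> is injective on the integers.
\<close>

section \<open>Persistence of singular values\<close>

lemma converges_locally_uniformly_compact:
  assumes "converges_locally_uniformly gs g" "compact K"
  shows "uniform_limit K gs g sequentially"
proof -
  obtain U where U: "\<forall>z. open (U z) \<and> z \<in> U z \<and> uniform_limit (U z) gs g sequentially"
    using choice[OF assms(1)[unfolded converges_locally_uniformly_def]] by (rule exE)
  obtain D where "finite D" "K \<subseteq> (\<Union>z\<in>D. U z)"
  proof (rule compactE_image[OF assms(2), of UNIV U])
    show "open (U z)" for z
      using U by simp
    show "K \<subseteq> (\<Union>z\<in>UNIV. U z)"
      using U by auto
  qed
  moreover have "uniform_limit (\<Union>z\<in>D. U z) gs g sequentially"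
    using \<open>finite D\<close> U by (intro uniform_limit_on_UNION) simp_all
  ultimately show ?thesis
    using uniform_limit_on_subset by blast
qed

lemma converges_locally_uniformly_subseq:
  assumes "converges_locally_uniformly gs g" "strict_mono r"
  shows "converges_locally_uniformly (gs \<circ> r) g"
  unfolding converges_locally_uniformly_def
proof
  fix z
  obtain U where "open U" "z \<in> U" "uniform_limit U gs g sequentially"
    using assms(1) unfolding converges_locally_uniformly_def by blast
  moreover from this(3) have "uniform_limit U (gs \<circ> r) g sequentially"
    unfolding comp_def by (rule filterlim_compose) (rule filterlim_subseq[OF assms(2)])
  ultimately show "\<exists>U. open U \<and> z \<in> U \<and> uniform_limit U (gs \<circ> r) g sequentially"
    by blast
qed

text \<open>Map and point vary together, as they must when \<open>gs n\<close> is evaluated at an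
  inverse branch that itself depends on \<open>n\<close>.\<close>

lemma converges_locally_uniformly_tendsto:
  assumes "converges_locally_uniformly gs g" "isCont g z" "zs \<longlonglongrightarrow> z"
  shows "(\<lambda>n. gs n (zs n)) \<longlonglongrightarrow> g z"
proof (rule tendstoI)
  fix e :: real assume "e > 0"
  obtain U where U: "open U" "z \<in> U" "uniform_limit U gs g sequentially"
    using assms(1) unfolding converges_locally_uniformly_def by blast
  have "\<forall>\<^sub>F n in sequentially. zs n \<in> U"
    using U assms(3) by (simp add: topological_tendstoD)
  moreover have "\<forall>\<^sub>F n in sequentially. \<forall>x\<in>U. dist (gs n x) (g x) < e/2"
    using uniform_limitD[OF U(3), of "e/2"] \<open>e > 0\<close> by simp
  moreover have "(\<lambda>n. g (zs n)) \<longlonglongrightarrow> g z"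
    using assms(2,3) isCont_tendsto_compose by blast
  then have "\<forall>\<^sub>F n in sequentially. dist (g (zs n)) (g z) < e/2"
    using \<open>e > 0\<close> tendstoD[of "\<lambda>n. g (zs n)" "g z" sequentially "e/2"] by simp
  ultimately show "\<forall>\<^sub>F n in sequentially. dist (gs n (zs n)) (g z) < e"
    by eventually_elim (meson dist_triangle_half_l dist_commute_lessI dist_triangle_half_r)
qed

section \<open>Values of entire maps and coverings over regular values\<close>

text \<open>The definition of \<open>regular_value\<close> can be met with \<open>\<V> = {}\<close>
  by an open \<open>U\<close> outside the range. Little Picard excludes such a \<open>U\<close>,
  since a non-empty open set contains two points to omit.\<close>

lemma entire_hits_open:
  assumes "h holomorphic_on UNIV" "\<not> h constant_on UNIV" "open U" "U \<noteq> {}"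
  shows "\<exists>x. h x \<in> U"
proof (rule ccontr)
  assume no: "\<nexists>x. h x \<in> U"
  have "infinite U"
    using assms(3,4) finite_imp_not_open by blast
  then obtain a b where "a \<in> U" "b \<in> U" "a \<noteq> b"
    by (metis assms(4) finite.emptyI finite_insert insertI1 subsetI subset_singletonD ex_in_conv finite_subset)
  then have "range h \<inter> {a,b} = {}"
    using no by auto
  then obtain c where "h = (\<lambda>x. c)"
    using little_Picard[OF assms(1) \<open>a \<noteq> b\<close>] by blast
  then show False
    using assms(2) by (auto simp: constant_on_def)
qed

text \<open>Liouville, after bounding \<open>h\<close> on a compact disc. This supplies two points,
  one of them arbitrarily far away, that inverse branches will omit.\<close>

lemma entire_unbounded_near_infinity:
  assumes "h holomorphic_on UNIV" "\<not> h constant_on UNIV" "bounded B"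
  shows "\<exists>x. norm x > R \<and> h x \<notin> B"
proof (rule ccontr)
  assume "\<nexists>x. norm x > R \<and> h x \<notin> B"
  then have "range h \<subseteq> h ` cball 0 R \<union> B"
    by (force simp: image_iff not_less)
  moreover have "continuous_on (cball 0 R) h"
    using assms(1) holomorphic_on_imp_continuous_on holomorphic_on_subset by blast
  then have "bounded (h ` cball 0 R)"
    by (meson compact_cball compact_continuous_image compact_imp_bounded)
  ultimately have "bounded (range h)"
    using assms(3) bounded_subset bounded_Un by blast
  then show False
    using Liouville_theorem assms by blast
qed

text \<open>The sheets are those of \<open>regular_value\<close>, cut down to the preimage of
  \<open>T\<close>. Surjectivity holds because \<open>entire_hits_open\<close> provides a sheet and
  each sheet maps onto all of \<open>U\<close>.\<close>

lemma covering_space_regular_values: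
  assumes hol: "h holomorphic_on UNIV" and nc: "\<not> h constant_on UNIV"
    and T: "T \<subseteq> - singular_values h"
  shows "covering_space (h -` T) h T"
proof
  show "continuous_on (h -` T) h"
    using hol holomorphic_on_imp_continuous_on continuous_on_subset by blast
next
  have reg: "\<exists>U \<V>. open U \<and> y \<in> U \<and> \<Union>\<V> = h -` U \<and> pairwise disjnt \<V> \<and>
             (\<forall>V\<in>\<V>. open V \<and> (\<exists>k. homeomorphism V U h k))" if "y \<in> T" for y
  proof -
    have "regular_value h y"
      using that T by (auto simp: singular_values_def)
    then show ?thesis
      unfolding regular_value_def by blast
  qed
  show "h ` (h -` T) = T"
  proof
    show "T \<subseteq> h ` (h -` T)"
    proof
      fix y assume y: "y \<in> T"
      obtain U \<V> where U: "open U" "y \<in> U" "\<Union>\<V> = h -` U"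
        "\<forall>V\<in>\<V>. open V \<and> (\<exists>k. homeomorphism V U h k)"
        using reg[OF y] by blast
      obtain x where "h x \<in> U"
        using entire_hits_open[OF hol nc, of U] U by blast
      then obtain V k where "V \<in> \<V>" "homeomorphism V U h k"
        using U by blast
      then have "y \<in> h ` V"
        using U(2) by (simp add: homeomorphism_def)
      then show "y \<in> h ` (h -` T)"
        using y by auto
    qed
  qed auto
  fix y assume y: "y \<in> T"
  obtain U \<V> where U: "open U" "y \<in> U" "\<Union>\<V> = h -` U" "pairwise disjnt \<V>"
    "\<forall>V\<in>\<V>. open V \<and> (\<exists>k. homeomorphism V U h k)"
    using reg[OF y] by blast
  let ?W = "(\<lambda>V. V \<inter> h -` T) ` \<V>"
  have "\<Union>?W = h -` T \<inter> h -` (T \<inter> U)"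
    using U(3) by auto
  moreover have "openin (top_of_set (h -` T)) (V \<inter> h -` T)" if "V \<in> \<V>" for V
    using U(5) that openin_open_Int[of V "h -` T"] by (simp add: Int_commute)
  moreover have "pairwise disjnt ?W"
    using U(4) by (fastforce simp: pairwise_def disjnt_def)
  moreover have "\<exists>k. homeomorphism (V \<inter> h -` T) (T \<inter> U) h k" if V: "V \<in> \<V>" for V
  proof -
    obtain k where k: "homeomorphism V U h k"
      using U(5) V by blast
    have "h ` (V \<inter> h -` T) = T \<inter> U"
      using k by (auto simp: homeomorphism_def image_iff)
    then have "homeomorphism (V \<inter> h -` T) (T \<inter> U) h k"
      by (intro homeomorphism_of_subsets[OF k, of _ "T \<inter> U"]) auto
    then show ?thesis by blast
  qed
  ultimately show "\<exists>N. y \<in> N \<and> openin (top_of_set T) N \<and>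
     (\<exists>v. \<Union>v = h -` T \<inter> h -` N \<and> (\<forall>u\<in>v. openin (top_of_set (h -` T)) u) \<and>
        pairwise disjnt v \<and> (\<forall>u\<in>v. \<exists>q. homeomorphism u N h q))"
    using U(1,2) y
    by (intro exI[of _ "T \<inter> U"] conjI exI[of _ ?W]) (auto simp: openin_open_Int)
qed

text \<open>The sheets are the images of \<open>U\<close> under all continuous sections of
  \<open>g\<close>. They are open by invariance of domain, and disjoint because sections that agree
  at one point agree on the connected set \<open>U\<close>.\<close>

lemma regular_valueI_inverse_branches:
  fixes g :: "complex \<Rightarrow> complex"
  assumes U: "open U" "connected U" "y \<in> U"
    and br: "\<And>z. g z \<in> U \<Longrightarrow>
      \<exists>\<psi>. continuous_on U \<psi> \<and> (\<forall>x\<in>U. g (\<psi> x) = x) \<and> \<psi> (g z) = z"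
    and contg: "continuous_on UNIV g"
  shows "regular_value g y"
proof -
  define \<Psi> where "\<Psi> = {\<psi>. continuous_on U \<psi> \<and> (\<forall>x\<in>U. g (\<psi> x) = x)}"
  have inj: "inj_on \<psi> U" if "\<psi> \<in> \<Psi>" for \<psi>
    using that by (auto simp: \<Psi>_def intro: inj_on_inverseI)
  have op: "open (\<psi> ` V)" if "\<psi> \<in> \<Psi>" "open V" "V \<subseteq> U" for \<psi> V
    using that inj[OF that(1)] unfolding \<Psi>_def
    by (intro invariance_of_domain) (auto intro: continuous_on_subset inj_on_subset)
  have agree: "\<psi> x = \<psi>' x" if P: "\<psi> \<in> \<Psi>" "\<psi>' \<in> \<Psi>" and a: "a \<in> U" "\<psi> a = \<psi>' a" and x: "x \<in> U" for \<psi> \<psi>' a x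
  proof -
    let ?E = "{x\<in>U. \<psi> x = \<psi>' x}"
    have E: "?E = U \<inter> (\<lambda>x. \<psi> x - \<psi>' x) -` {0}" by auto
    have cd: "continuous_on U (\<lambda>x. \<psi> x - \<psi>' x)"
      using P by (intro continuous_intros) (auto simp: \<Psi>_def)
    have "closedin (top_of_set U) ?E"
      unfolding E by (rule continuous_closedin_preimage[OF cd]) auto
    \<comment> \<open>Openness: applying \<open>g\<close> to \<open>\<psi>' x = \<psi> u\<close>
      gives \<open>x = u\<close>, so the coincidence set is the preimage under
      \<open>\<psi>'\<close> of the open image of \<open>\<psi>\<close>.\<close>
    moreover have E2: "?E = U \<inter> \<psi>' -` (\<psi> ` U)"
    proof
      show "U \<inter> \<psi>' -` (\<psi> ` U) \<subseteq> ?E"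
      proof
        fix x assume "x \<in> U \<inter> \<psi>' -` (\<psi> ` U)"
        then obtain u where "u \<in> U" "\<psi>' x = \<psi> u" "x \<in> U" by auto
        moreover then have "x = u"
          using P unfolding \<Psi>_def by (metis (mono_tags, lifting) mem_Collect_eq)
        ultimately show "x \<in> ?E" by auto
      qed
    qed force
    have "open ?E"
      unfolding E2 using P op[OF P(1) U(1)] U(1)
      by (intro continuous_open_preimage) (auto simp: \<Psi>_def)
    then have "openin (top_of_set U) ?E"
      by (simp add: open_openin_trans U(1) openin_open_eq)
    ultimately have "?E = {} \<or> ?E = U"
      using U(2) connected_clopen by blast
    then show ?thesis
      using a x by auto
  qed
  let ?V = "(\<lambda>\<psi>. \<psi> ` U) ` \<Psi>"
  have "\<Union>?V = g -` U"
  proof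
    show "g -` U \<subseteq> \<Union>?V"
    proof
      fix z assume "z \<in> g -` U"
      then obtain \<psi> where "\<psi> \<in> \<Psi>" "\<psi> (g z) = z" "g z \<in> U"
        using br by (auto simp: \<Psi>_def)
      then show "z \<in> \<Union>?V"
        using UN_I[of \<psi> \<Psi> z "\<lambda>\<psi>. \<psi> ` U"] by (metis image_eqI)
    qed
  qed (auto simp: \<Psi>_def)
  moreover have "pairwise disjnt ?V"
  proof (rule pairwiseI)
    fix A B assume AB: "A \<in> ?V" "B \<in> ?V" "A \<noteq> B"
    then obtain \<psi> \<psi>' where P: "\<psi> \<in> \<Psi>" "\<psi>' \<in> \<Psi>" "A = \<psi> ` U" "B = \<psi>' ` U"
      by auto
    show "disjnt A B"
    proof (rule ccontr)
      assume "\<not> disjnt A B"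
      then obtain a b where ab: "a \<in> U" "b \<in> U" "\<psi> a = \<psi>' b"
        using P by (auto simp: disjnt_def)
      then have "a = b"
        using P unfolding \<Psi>_def by (metis (mono_tags, lifting) mem_Collect_eq)
      then have "\<psi> a = \<psi>' a"
        using ab by simp
      then have "\<psi> ` U = \<psi>' ` U"
        using agree[OF P(1,2) ab(1)] by (intro image_cong) blast+
      then show False
        using AB P by auto
    qed
  qed
  moreover have "open (\<psi> ` U)" "\<exists>h. homeomorphism (\<psi> ` U) U g h" if P: "\<psi> \<in> \<Psi>" for \<psi>
  proof -
    show "open (\<psi> ` U)"
      using op[OF P U(1)] by auto
    have "homeomorphism (\<psi> ` U) U g \<psi>"
      using P continuous_on_subset[OF contg] unfolding homeomorphism_def \<Psi>_def by force
    then show "\<exists>h. homeomorphism (\<psi> ` U) U g h" by blast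
  qed
  ultimately show ?thesis
    unfolding regular_value_def using U(1,3)
    by (intro exI[of _ U] conjI exI[of _ ?V]) auto
qed

section \<open>Limits of inverse branches and the location of singular values\<close>

text \<open>The disc is simply connected, so the coverings \<open>gs n\<close> have sections over it
  that take \<open>gs n z\<close> to \<open>z\<close>. These omit two fixed values and form a normal
  family, whose limits are right inverses of \<open>g\<close>. Halving the radius leaves room to
  move \<open>gs n z\<close> to \<open>g z\<close>.\<close>

lemma inverse_branch_limit:
  assumes hol: "\<And>n. gs n holomorphic_on UNIV" and nc: "\<And>n. \<not> gs n constant_on UNIV"
    and g: "g holomorphic_on UNIV" "\<not> g constant_on UNIV"
    and conv: "converges_locally_uniformly gs g"
    and reg: "\<And>n. ball s r \<subseteq> - singular_values (gs n)"
    and z: "g z \<in> ball s (r/2)"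
  shows "\<exists>\<psi>. \<psi> holomorphic_on ball s (r/2) \<and> (\<forall>x\<in>ball s (r/2). g (\<psi> x) = x) \<and> \<psi> (g z) = z"
proof -
  have r: "r > 0"
    using z by (metis ball_empty empty_iff half_gt_zero_iff not_less)
  have contg: "isCont g x" for x
    using g(1) by (simp add: holomorphic_on_imp_continuous_on continuous_on_interior[of UNIV])
  have pt: "(\<lambda>n. gs n x) \<longlonglongrightarrow> g x" for x
    using converges_locally_uniformly_tendsto[OF conv contg tendsto_const] .
  \<comment> \<open>For large \<open>n\<close> the values \<open>gs n a\<close> and
    \<open>gs n b\<close> stay outside \<open>cball s r\<close>, so no section of
    \<open>gs n\<close> over the disc takes the value \<open>a\<close> or \<open>b\<close>.\<close>
  obtain a where a: "g a \<notin> cball s r"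
    using entire_unbounded_near_infinity[OF g bounded_cball] by blast
  obtain b where b: "g b \<notin> cball s r" "norm b > norm a + norm (z - a)"
    using entire_unbounded_near_infinity[OF g bounded_cball] by blast
  have zab: "norm (z - a) \<le> norm (b - a)" "b \<noteq> a"
    using b(2) norm_triangle_ineq2[of b a] norm_ge_zero[of "z - a"] by (linarith, force)
  have "\<forall>\<^sub>F n in sequentially. gs n x \<in> - cball s r" if "g x \<notin> cball s r" for x
    using that pt[of x] by (intro topological_tendstoD) auto
  moreover have "\<forall>\<^sub>F n in sequentially. dist (gs n z) (g z) < r/2"
    using tendstoD[OF pt, of "r/2"] r by simp
  ultimately have "\<forall>\<^sub>F n in sequentially. gs n a \<in> - cball s r \<and> gs n b \<in> - cball s r \<and> dist (gs n z) (g z) < r/2"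
    using a b(1) by (simp add: eventually_conj_iff)
  then obtain N where N: "\<And>n. n \<ge> N \<Longrightarrow> gs n a \<notin> cball s r \<and> gs n b \<notin> cball s r \<and> dist (gs n z) (g z) < r/2"
    unfolding eventually_sequentially by auto
  \<comment> \<open>Dropping the first \<open>N\<close> terms makes the eventual conditions hold for
    every \<open>n\<close>.\<close>
  define hs where "hs = gs \<circ> (\<lambda>n. n + N)"
  have conv': "converges_locally_uniformly hs g"
    unfolding hs_def by (rule converges_locally_uniformly_subseq[OF conv]) (simp add: strict_mono_def)
  have hs: "hs n a \<notin> cball s r" "hs n b \<notin> cball s r" "dist (hs n z) (g z) < r/2"
    "hs n holomorphic_on UNIV" "ball s r \<subseteq> - singular_values (hs n)" "\<not> hs n constant_on UNIV" for n
    using N[of "n + N"] hol reg nc by (auto simp: hs_def)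
  define d where "d n = hs n z - g z" for n
  have "\<exists>\<phi>. \<phi> holomorphic_on ball s r \<and> (\<forall>x\<in>ball s r. hs n (\<phi> x) = x) \<and> \<phi> (hs n z) = z" for n
  proof -
    have cov: "covering_space (hs n -` ball s r) (hs n) (ball s r)"
      using covering_space_regular_values[OF hs(4) hs(6) hs(5)] .
    have zin: "hs n z \<in> ball s r"
      using z hs(3)[of n] dist_triangle_half_l[of s "g z" r "hs n z"] by (simp add: dist_commute)
    obtain \<phi> where \<phi>: "continuous_on (ball s r) \<phi>" "\<phi> \<in> ball s r \<rightarrow> hs n -` ball s r"
      "\<phi> (hs n z) = z" "\<And>y. y \<in> ball s r \<Longrightarrow> hs n (\<phi> y) = y"
      by (rule covering_space_lift_strong[OF cov, of z "hs n z" "ball s r" "\<lambda>x. x"])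
         (use zin in \<open>auto simp: convex_imp_simply_connected convex_imp_locally_path_connected\<close>)
    have "\<phi> holomorphic_on ball s r"
      by (rule covering_space_lift_is_holomorphic[OF cov _ _ _ _ \<phi>(2,1,4)])
         (use hs(4)[of n] in \<open>auto intro: holomorphic_intros open_vimage holomorphic_on_imp_continuous_on holomorphic_on_subset\<close>)
    then show ?thesis
      using \<phi> by auto
  qed
  then obtain \<phi> where \<phi>: "\<And>n. \<phi> n holomorphic_on ball s r"
    "\<And>n x. x \<in> ball s r \<Longrightarrow> hs n (\<phi> n x) = x" "\<And>n. \<phi> n (hs n z) = z"
    by metis
  have shift: "x + d n \<in> ball s r" if "x \<in> ball s (r/2)" for x n
  proof -
    have "dist x (x + d n) < r/2"
      using hs(3)[of n] by (simp add: dist_norm d_def norm_minus_commute)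
    then show ?thesis
      using that dist_triangle_half_l[of s x r "x + d n"] by (simp add: dist_commute)
  qed
  \<comment> \<open>The shift by \<open>d n\<close> makes every branch send \<open>g z\<close> to \<open>z\<close>; the affine change turns the omitted
    values \<open>a\<close>, \<open>b\<close> into \<open>0\<close>, \<open>1\<close>, and the choice of a large \<open>b\<close> bounds the value at \<open>g z\<close> by \<open>1\<close>.\<close>
  define F where "F n x = (\<phi> n (x + d n) - a) / (b - a)" for n x
  have Fhol: "F n holomorphic_on ball s (r/2)" for n
  proof -
    have "(\<phi> n \<circ> (\<lambda>x. x + d n)) holomorphic_on ball s (r/2)"
      by (rule holomorphic_on_compose_gen[OF _ \<phi>(1)[of n]]) (use shift in \<open>auto intro!: holomorphic_intros\<close>)
    then show ?thesis
      unfolding F_def[abs_def] comp_def using zab by (intro holomorphic_intros) auto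
  qed
  have F01: "F n x \<noteq> 0 \<and> F n x \<noteq> 1" if "x \<in> ball s (r/2)" for n x
  proof -
    have *: "hs n (\<phi> n (x + d n)) \<in> ball s r"
      using \<phi>(2) shift[OF that] by simp
    then have "\<phi> n (x + d n) \<noteq> a" "\<phi> n (x + d n) \<noteq> b"
      using hs(1,2)[of n] by (metis ball_subset_cball subsetD)+
    then show ?thesis
      using zab by (auto simp: F_def field_simps)
  qed
  have Fw: "F n (g z) = (z - a) / (b - a)" for n
    using \<phi>(3) by (simp add: F_def d_def)
  \<comment> \<open>\<open>GPicard3\<close> bounds functions omitting \<open>0\<close> and
    \<open>1\<close> on compact sets, uniformly over a family whose values at one point are bounded
    by \<open>1\<close>; here that point is \<open>g z\<close>.\<close>
  have bd: "\<exists>B. \<forall>h\<in>range F. \<forall>x\<in>K. norm (h x) \<le> B" if K: "compact K" "K \<subseteq> ball s (r/2)" for K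
  proof -
    obtain B where "\<And>h x. \<lbrakk>h \<in> range F; x \<in> K\<rbrakk> \<Longrightarrow> norm (h x) \<le> B"
      by (rule GPicard3[of "ball s (r/2)" "g z" "range F" "range F" K])
         (use z Fhol F01 Fw zab K in \<open>auto simp: norm_divide divide_le_eq\<close>)
    then show ?thesis by blast
  qed
  obtain G k where G: "G holomorphic_on ball s (r/2)" "strict_mono (k :: nat \<Rightarrow> nat)"
    "\<And>x. x \<in> ball s (r/2) \<Longrightarrow> (\<lambda>n. F (k n) x) \<longlonglongrightarrow> G x"
    by (rule Montel[of "ball s (r/2)" "range F" F]) (use Fhol bd in auto)
  define \<psi> where "\<psi> x = a + (b - a) * G x" for x
  have lim: "(\<lambda>n. \<phi> (k n) (x + d (k n))) \<longlonglongrightarrow> \<psi> x" if "x \<in> ball s (r/2)" for x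
  proof -
    have "(\<lambda>n. a + (b - a) * F (k n) x) \<longlonglongrightarrow> \<psi> x"
      unfolding \<psi>_def by (intro tendsto_intros G that)
    then show ?thesis
      using zab by (simp add: F_def)
  qed
  have d0: "(\<lambda>n. d (k n)) \<longlonglongrightarrow> 0"
  proof -
    have "(\<lambda>n. hs n z) \<longlonglongrightarrow> g z"
      using converges_locally_uniformly_tendsto[OF conv' contg tendsto_const] .
    then have "d \<longlonglongrightarrow> 0"
      unfolding d_def[abs_def] by (simp add: LIM_zero)
    then show ?thesis
      using LIMSEQ_subseq_LIMSEQ[OF _ G(2)] by (simp add: comp_def)
  qed
  have "g (\<psi> x) = x" if x: "x \<in> ball s (r/2)" for x
  proof -
    have "(\<lambda>n. (hs \<circ> k) n (\<phi> (k n) (x + d (k n)))) \<longlonglongrightarrow> g (\<psi> x)"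
      by (rule converges_locally_uniformly_tendsto[OF converges_locally_uniformly_subseq[OF conv' G(2)] contg lim[OF x]])
    moreover have "(hs \<circ> k) n (\<phi> (k n) (x + d (k n))) = x + d (k n)" for n
      using \<phi>(2) shift[OF x] by simp
    ultimately have "(\<lambda>n. x + d (k n)) \<longlonglongrightarrow> g (\<psi> x)"
      by simp
    moreover have "(\<lambda>n. x + d (k n)) \<longlonglongrightarrow> x + 0"
      by (intro tendsto_intros d0)
    ultimately show ?thesis
      using LIMSEQ_unique by fastforce
  qed
  moreover have "\<psi> (g z) = z"
  proof -
    have "(\<lambda>n. z) \<longlonglongrightarrow> \<psi> (g z)"
      using lim[OF z] \<phi>(3) by (simp add: d_def)
    then show ?thesis
      using LIMSEQ_unique tendsto_const by blast
  qed
  moreover have "\<psi> holomorphic_on ball s (r/2)"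
    unfolding \<psi>_def[abs_def] by (intro holomorphic_intros G)
  ultimately show ?thesis
    by blast
qed

text \<open>Otherwise a subsequence has no singular value in \<open>ball s r\<close>, and its
  limiting inverse branches over the half disc make \<open>s\<close> a regular value.\<close>

lemma singular_value_persists:
  assumes hol: "\<And>n. gs n holomorphic_on UNIV" and nc: "\<And>n. \<not> gs n constant_on UNIV"
    and g: "g holomorphic_on UNIV" "\<not> g constant_on UNIV"
    and conv: "converges_locally_uniformly gs g"
    and s: "s \<in> singular_values g" and r: "r > 0"
  shows "\<forall>\<^sub>F n in sequentially. singular_values (gs n) \<inter> ball s r \<noteq> {}"
proof (rule ccontr)
  assume "\<not> ?thesis"
  then have "\<exists>\<^sub>F n in sequentially. singular_values (gs n) \<inter> ball s r = {}"
    by (simp add: frequently_def)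
  then have "infinite {n. singular_values (gs n) \<inter> ball s r = {}}"
    by (simp add: frequently_cofinite cofinite_eq_sequentially[symmetric])
  then obtain k :: "nat \<Rightarrow> nat" where k: "strict_mono k" "\<And>n. singular_values (gs (k n)) \<inter> ball s r = {}"
    using infinite_enumerate[of "{n. singular_values (gs n) \<inter> ball s r = {}}"]
    unfolding mem_Collect_eq by metis
  have "\<exists>\<psi>. \<psi> holomorphic_on ball s (r/2) \<and> (\<forall>x\<in>ball s (r/2). g (\<psi> x) = x) \<and> \<psi> (g z) = z"
    if "g z \<in> ball s (r/2)" for z
    by (rule inverse_branch_limit[OF _ _ g converges_locally_uniformly_subseq[OF conv k(1)] _ that])
       (use hol nc k in auto)
  then have "regular_value g s"
    using r holomorphic_on_imp_continuous_on[OF g(1)] holomorphic_on_imp_continuous_on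
    by (intro regular_valueI_inverse_branches[of "ball s (r/2)"]) (auto, blast)
  then show False
    using s by (simp add: singular_values_def)
qed

text \<open>Disjoint discs about the singular values of \<open>g\<close>, chosen off
  \<open>K\<close>, each catch a singular value of \<open>gs n\<close>. Since the cardinalities
  agree, these are all of them.\<close>

lemma eventually_avoids_singular_values:
  assumes g: "entire_of_finite_type g" and gs: "\<And>n. entire_of_finite_type (gs n)"
    and cd: "\<And>n. card (singular_values (gs n)) = card (singular_values g)"
    and conv: "converges_locally_uniformly gs g"
    and K: "closed K" "K \<subseteq> - singular_values g"
  shows "\<forall>\<^sub>F n in sequentially. K \<subseteq> - singular_values (gs n)"
proof -
  let ?S = "singular_values g"
  have fin: "finite ?S" "\<And>n. finite (singular_values (gs n))"
    using g gs by (auto simp: entire_of_finite_type_def)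
  \<comment> \<open>The factor \<open>2\<close> makes the discs of radius \<open>r s\<close>
    pairwise disjoint although the radii vary with \<open>s\<close>.\<close>
  have "\<exists>r>0. \<forall>y\<in>K \<union> (?S - {s}). 2 * r \<le> dist s y" if "s \<in> ?S" for s
  proof -
    have "closed (K \<union> (?S - {s}))" "s \<notin> K \<union> (?S - {s})"
      using K fin that by (auto intro: finite_imp_closed)
    from separate_point_closed[OF this]
    obtain d where "d > 0" "\<forall>y\<in>K \<union> (?S - {s}). d \<le> dist s y"
      by blast
    then show ?thesis
      by (intro exI[of _ "d/2"]) auto
  qed
  then obtain r where r: "\<And>s. s \<in> ?S \<Longrightarrow> r s > 0"
    "\<And>s y. \<lbrakk>s \<in> ?S; y \<in> K \<union> (?S - {s})\<rbrakk> \<Longrightarrow> 2 * r s \<le> dist s y"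
    by metis
  have disj: "s = t" if "s \<in> ?S" "t \<in> ?S" "x \<in> ball s (r s)" "x \<in> ball t (r t)" for s t x
  proof (rule ccontr)
    assume "s \<noteq> t"
    then have "2 * r s \<le> dist s t" "2 * r t \<le> dist s t"
      using r(2)[of s t] r(2)[of t s] that by (auto simp: dist_commute)
    moreover have "dist s t < r s + r t"
      using that dist_triangle[of s t x] by (auto simp: dist_commute)
    ultimately show False by linarith
  qed
  have "\<forall>\<^sub>F n in sequentially. \<forall>s\<in>?S. singular_values (gs n) \<inter> ball s (r s) \<noteq> {}"
    using g gs r(1) unfolding entire_of_finite_type_def
    by (intro eventually_ball_finite ballI singular_value_persists[OF _ _ _ _ conv]) auto
  then show ?thesis
  proof eventually_elim
    case (elim n)
    then have "\<forall>s\<in>?S. \<exists>t. t \<in> singular_values (gs n) \<inter> ball s (r s)"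
      by blast
    then obtain f where f: "\<And>s. s \<in> ?S \<Longrightarrow> f s \<in> singular_values (gs n) \<inter> ball s (r s)"
      by metis
    have "inj_on f ?S"
      using f disj by (intro inj_onI) (metis IntD2)
    then have "f ` ?S = singular_values (gs n)"
      using f fin cd by (intro card_subset_eq) (auto simp: card_image)
    moreover have "f s \<notin> K" if "s \<in> ?S" for s
      using f[OF that] r(1)[OF that] r(2)[OF that, of "f s"] by fastforce
    then have "f ` ?S \<inter> K = {}" by blast
    ultimately show ?case by blast
  qed
qed

section \<open>Lifts of a periodic parametrization\<close>

text \<open>\<open>p\<close> is the universal covering of the closed curve by the line. The single
  condition \<open>eq_iff\<close> says both that \<open>1\<close> is a period and that only integer
  shifts give coincidences.\<close>

locale closed_curve_param =
  fixes p :: "real \<Rightarrow> complex" and \<gamma> :: "complex set"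
  assumes cont: "continuous_on UNIV p"
    and range_p: "range p = \<gamma>"
    and eq_iff: "p s = p t \<longleftrightarrow> s - t \<in> \<int>"

text \<open>A homeomorphism from the unit circle is composed with the exponential parametrization.
  The rotation by \<open>w\<close> puts the prescribed point at time \<open>0\<close>.\<close>

lemma exists_closed_curve_param:
  assumes "simple_closed_curve \<gamma>" "y \<in> \<gamma>"
  obtains p where "closed_curve_param p \<gamma>" "p 0 = y"
proof -
  obtain c where c: "simple_path c" "pathfinish c = pathstart c" "\<gamma> = path_image c"
    using assms(1) unfolding simple_closed_curve_def by blast
  have "sphere (0::complex) 1 homeomorphic \<gamma>"
    using homeomorphic_simple_path_image_circle[OF c(1,2), of 1 0] c(3) homeomorphic_sym zero_less_one by metis
  then obtain k l where kl: "homeomorphism (sphere (0::complex) 1) \<gamma> k l"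
    unfolding homeomorphic_def by blast
  have inj: "inj_on k (sphere 0 1)"
    using kl by (metis homeomorphism_apply1 inj_on_inverseI)
  have k: "continuous_on (sphere 0 1) k" "k ` sphere 0 1 = \<gamma>"
    using kl by (auto simp: homeomorphism_def)
  obtain w where w: "w \<in> sphere 0 1" "k w = y"
    using k(2) assms(2) by blast
  define p where "p t = k (w * cis (2 * pi * t))" for t
  have sph: "w * cis x \<in> sphere 0 1" for x
    using w(1) by (simp add: norm_mult)
  have "w \<noteq> 0"
    using w(1) by auto
  have "p s = p t \<longleftrightarrow> s - t \<in> \<int>" for s t
  proof -
    have "p s = p t \<longleftrightarrow> cis (2 * pi * s) = cis (2 * pi * t)"
      using inj_on_eq_iff[OF inj sph sph] \<open>w \<noteq> 0\<close> by (simp add: p_def)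
    also have "\<dots> \<longleftrightarrow> (\<exists>n::int. 2 * pi * s = 2 * pi * t + of_int (2 * n) * pi)"
      unfolding cis_conv_exp exp_eq by (simp add: complex_eq_iff mult.commute)
    also have "\<dots> \<longleftrightarrow> (\<exists>n::int. s - t = of_int n)"
    proof -
      have "2 * pi * s = 2 * pi * t + of_int (2 * n) * pi \<longleftrightarrow> s - t = of_int n" for n
      proof -
        have "2 * pi * s = 2 * pi * t + of_int (2 * n) * pi \<longleftrightarrow> (2 * pi) * (s - t) = (2 * pi) * of_int n"
          by (auto simp: algebra_simps)
        then show ?thesis by simp
      qed
      then show ?thesis by simp
    qed
    also have "\<dots> \<longleftrightarrow> s - t \<in> \<int>"
      by (auto simp: Ints_def)
    finally show ?thesis .
  qed
  moreover have "continuous_on UNIV p"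
    unfolding p_def by (rule continuous_on_compose2[OF k(1)]) (use sph in \<open>auto intro!: continuous_intros\<close>)
  moreover have "range p = \<gamma>"
  proof
    show "range p \<subseteq> \<gamma>"
      using k(2) sph by (auto simp: p_def)
    show "\<gamma> \<subseteq> range p"
    proof
      fix x assume "x \<in> \<gamma>"
      then obtain u where u: "u \<in> sphere 0 1" "x = k u"
        using k(2) by blast
      then have "norm (u / w) = 1"
        using w(1) by (simp add: norm_divide)
      then have "u / w = cis (Arg (u / w))"
        using cis_Arg[of "u/w"] by (cases "u / w = 0") (auto simp: sgn_div_norm)
      then have "u = w * cis (2 * pi * (Arg (u/w) / (2 * pi)))"
        using \<open>w \<noteq> 0\<close> by (simp add: field_simps)
      then have "x = p (Arg (u/w) / (2 * pi))"
        unfolding p_def using u(2) by simp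
      then show "x \<in> range p" by blast
    qed
  qed
  ultimately have "closed_curve_param p \<gamma>"
    by unfold_locales auto
  moreover have "p 0 = y"
    by (simp add: p_def w)
  ultimately show ?thesis
    using that by blast
qed

context closed_curve_param
begin

lemma p_in [simp]: "p t \<in> \<gamma>"
  using range_p by blast

lemma p_shift [simp]: "p (t + of_int k) = p t"
  by (simp add: eq_iff)

lemma p_eqE:
  assumes "p s = p t"
  obtains k :: int where "s - t = of_int k"
  using assms eq_iff Ints_cases by metis

text \<open>One period about \<open>t\<close>, with the \<tau>-neighbourhood of \<open>t\<close>
  removed, is compact and its image misses \<open>p t\<close>; \<open>r\<close> is the distance
  between the two.\<close>

lemma locally_onto:
  assumes "\<tau> > 0"
  obtains r where "r > 0" "\<And>y. \<lbrakk>y \<in> \<gamma>; dist (p t) y < r\<rbrakk> \<Longrightarrow> \<exists>t'. \<bar>t' - t\<bar> < \<tau> \<and> p t' = y"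
proof -
  define C where "C = {t - 1/2..t + 1/2} - ball t \<tau>"
  have "compact C"
    unfolding C_def by (intro compact_diff) auto
  then have "compact (p ` C)"
    using compact_continuous_image continuous_on_subset[OF cont] by blast
  moreover have "p t \<notin> p ` C"
  proof
    assume "p t \<in> p ` C"
    then obtain u where pu: "p t = p u" and u: "u \<in> C"
      by (rule imageE)
    obtain n :: int where n: "u - t = of_int n"
      using p_eqE[OF pu[symmetric]] .
    then have "\<bar>real_of_int n\<bar> < 1"
      using u unfolding n[symmetric] C_def by auto
    then have "n = 0" by linarith
    then have "u = t"
      using n by simp
    then show False
      using u assms by (simp add: C_def)
  qed
  ultimately have "\<exists>r>0. \<forall>y\<in>p ` C. r \<le> dist (p t) y"
    by (intro separate_point_closed compact_imp_closed)
  then obtain r where r: "r > 0" "\<And>y. y \<in> p ` C \<Longrightarrow> r \<le> dist (p t) y"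
    by blast
  have "\<exists>t'. \<bar>t' - t\<bar> < \<tau> \<and> p t' = y" if y: "y \<in> \<gamma>" "dist (p t) y < r" for y
  proof -
    obtain u where u: "p u = y"
      using y(1) range_p by blast
    \<comment> \<open>Rounding moves the parameter by an integer into the period centred at
      \<open>t\<close>.\<close>
    define u' where "u' = u + of_int (- round (u - t))"
    have "p u' = y"
      unfolding u'_def p_shift by (rule u)
    moreover have "u' \<in> {t - 1/2..t + 1/2}"
      using of_int_round_abs_le[of "u - t"] unfolding u'_def of_int_minus atLeastAtMost_iff by linarith
    moreover have "u' \<notin> C"
    proof
      assume "u' \<in> C"
      then have "r \<le> dist (p t) y"
        using r(2) \<open>p u' = y\<close> by blast
      then show False
        using y(2) by simp
    qed
    ultimately have "\<bar>u' - t\<bar> < \<tau>"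
      unfolding C_def by (simp add: dist_real_def abs_minus_commute)
    then show ?thesis
      using \<open>p u' = y\<close> by blast
  qed
  then show ?thesis
    using that r(1) by blast
qed

lemma open_map:
  assumes "open J"
  shows "openin (top_of_set \<gamma>) (p ` J)"
  unfolding openin_euclidean_subtopology_iff
proof (intro conjI ballI)
  show "p ` J \<subseteq> \<gamma>" by auto
  fix x assume "x \<in> p ` J"
  then obtain t where t: "t \<in> J" "x = p t" by blast
  obtain \<tau> where \<tau>: "\<tau> > 0" "ball t \<tau> \<subseteq> J"
    using assms t(1) openE by blast
  obtain r where r: "r > 0" "\<And>y. \<lbrakk>y \<in> \<gamma>; dist (p t) y < r\<rbrakk> \<Longrightarrow> \<exists>t'. \<bar>t' - t\<bar> < \<tau> \<and> p t' = y"
    using locally_onto[OF \<tau>(1)] by blast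
  show "\<exists>e>0. \<forall>x'\<in>\<gamma>. dist x' x < e \<longrightarrow> x' \<in> p ` J"
  proof (intro exI[of _ r] conjI ballI impI r(1))
    fix x' assume "x' \<in> \<gamma>" "dist x' x < r"
    then have "x' \<in> \<gamma>" "dist (p t) x' < r"
      using t(2) by (simp_all add: dist_commute)
    then obtain t' where t': "\<bar>t' - t\<bar> < \<tau>" "p t' = x'"
      using r(2) by blast
    then have "t' \<in> J"
      using \<tau>(2) by (auto simp: dist_real_def abs_minus_commute subset_iff)
    then show "x' \<in> p ` J"
      using t'(2) by blast
  qed
qed

end

text \<open>\<open>h\<close> is a parameter because the locale serves both \<open>g\<close> and the
  maps \<open>gs n\<close>, for which the covering property is known only when \<open>n\<close> is
  large.\<close>

locale curve_lift = closed_curve_param +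
  fixes h :: "complex \<Rightarrow> complex" and q :: "real \<Rightarrow> complex"
  assumes cov: "covering_space (h -` \<gamma>) h \<gamma>"
    and contq: "continuous_on UNIV q"
    and lift: "h (q t) = p t"
begin

lemma q_in [simp]: "h (q t) \<in> \<gamma>"
  by (simp add: lift)

lemma conth: "continuous_on (h -` \<gamma>) h"
  using cov covering_space_imp_continuous by blast

lemma shift: "curve_lift p \<gamma> h (\<lambda>t. q (t + of_int k))"
  by unfold_locales (auto intro!: cov continuous_on_compose2[OF contq] continuous_intros simp: lift)

text \<open>Near \<open>q t\<close> the map \<open>h\<close> is injective on an open piece of the
  preimage of \<gamma>. A point there with image close to \<open>p t\<close> has image
  \<open>p t'\<close> with \<open>t'\<close> near \<open>t\<close>, and injectivity identifies it
  with \<open>q t'\<close>.\<close>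

lemma lift_open_map:
  assumes "open J"
  shows "openin (top_of_set (h -` \<gamma>)) (q ` J)"
proof (subst openin_subopen, intro ballI)
  fix x assume "x \<in> q ` J"
  then obtain t where t: "t \<in> J" "x = q t" by blast
  obtain T U k where T: "q t \<in> T" "openin (top_of_set (h -` \<gamma>)) T" "homeomorphism T U h k"
    using covering_space_local_homeomorphism[OF cov, of "q t"] by (metis q_in vimageI)
  obtain V where V: "open V" "T = (h -` \<gamma>) \<inter> V"
    using T(2) openin_open by blast
  have "open (J \<inter> q -` V)"
    using assms V(1) contq by (intro open_Int) (auto simp: continuous_on_open_vimage)
  moreover have "t \<in> J \<inter> q -` V"
    using t T(1) V(2) by auto
  ultimately obtain \<tau> where \<tau>: "\<tau> > 0" "ball t \<tau> \<subseteq> J \<inter> q -` V"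
    using openE by blast
  obtain r where r: "r > 0" "\<And>y. \<lbrakk>y \<in> \<gamma>; dist (p t) y < r\<rbrakk> \<Longrightarrow> \<exists>t'. \<bar>t' - t\<bar> < \<tau> \<and> p t' = y"
    using locally_onto[OF \<tau>(1)] by blast
  let ?N = "T \<inter> (h -` \<gamma> \<inter> h -` ball (p t) r)"
  have "openin (top_of_set (h -` \<gamma>)) ?N"
    by (rule openin_Int[OF T(2) continuous_openin_preimage_gen[OF conth open_ball]])
  moreover have "x \<in> ?N"
    using t T(1) r(1) by (simp add: lift)
  moreover have "?N \<subseteq> q ` J"
  proof
    fix u assume u: "u \<in> ?N"
    then have "h u \<in> \<gamma>" "dist (p t) (h u) < r"
      by auto
    then obtain t' where t': "\<bar>t' - t\<bar> < \<tau>" "p t' = h u"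
      using r(2) by blast
    then have "t' \<in> ball t \<tau>"
      by (simp add: dist_real_def abs_minus_commute)
    then have "t' \<in> J" "q t' \<in> T"
      using \<tau>(2) V(2) by auto
    moreover have "h (q t') = h u"
      by (simp add: lift t')
    ultimately have "q t' = u"
      using T(3) u by (metis IntD1 homeomorphism_apply1)
    then show "u \<in> q ` J"
      using \<open>t' \<in> J\<close> by blast
  qed
  ultimately show "\<exists>N. openin (top_of_set (h -` \<gamma>)) N \<and> x \<in> N \<and> N \<subseteq> q ` J"
    by blast
qed

end

section \<open>Uniqueness, existence and ranges of lifts\<close>

context closed_curve_param
begin

lemma lift_unique:
  assumes "curve_lift p \<gamma> h q" "curve_lift p \<gamma> h q'" "q t = q' t"
  shows "q = q'"
proof
  fix x
  interpret q: curve_lift p \<gamma> h q by fact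
  interpret q': curve_lift p \<gamma> h q' by fact
  show "q x = q' x"
    by (rule covering_space_lift_unique[where c="h -` \<gamma>" and p=h and S=\<gamma> and f=p and T=UNIV and a=t and ?g1.0=q and ?g2.0=q', OF q.cov assms(3) cont])
       (auto simp: q.contq q'.contq q.lift q'.lift)
qed

lemma exists_lift:
  assumes cov: "covering_space (h -` \<gamma>) h \<gamma>" and a: "h a = p t"
  obtains q where "curve_lift p \<gamma> h q" "q t = a"
proof -
  obtain q where q: "continuous_on UNIV q" "q t = a" "\<And>y. y \<in> UNIV \<Longrightarrow> h (q y) = p y"
    by (rule covering_space_lift_strong[OF cov, of a t UNIV p])
       (use a cont in \<open>auto simp: convex_imp_simply_connected convex_imp_locally_path_connected\<close>)
  then have "curve_lift p \<gamma> h q"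
    by unfold_locales (auto simp: cov)
  then show ?thesis
    using that q(2) by blast
qed

text \<open>At a common point the two parameters differ by an integer \<open>k\<close>, so
  \<open>q'\<close> is \<open>q\<close> shifted by \<open>k\<close>. Ranges of lifts are therefore
  equal or disjoint.\<close>

lemma lift_ranges:
  assumes q: "curve_lift p \<gamma> h q" and q': "curve_lift p \<gamma> h q'" and "q s = q' t"
  shows "range q = range q'"
proof -
  interpret q: curve_lift p \<gamma> h q by fact
  interpret q': curve_lift p \<gamma> h q' by fact
  have "p s = p t"
    using assms(3) q.lift q'.lift by metis
  then obtain k :: int where k: "s = t + of_int k"
    using p_eqE by (metis add_diff_cancel_left' add_diff_eq)
  have "(\<lambda>t. q (t + of_int k)) = q'"
    by (rule lift_unique[OF q.shift q', where t=t]) (use assms(3) k in simp)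
  moreover have "range (\<lambda>t. q (t + of_int k)) = range q"
  proof
    show "range q \<subseteq> range (\<lambda>t. q (t + of_int k))"
    proof
      fix x assume "x \<in> range q"
      then obtain t where "x = q t" by blast
      then have "x = q ((t - of_int k) + of_int k)" by simp
      then show "x \<in> range (\<lambda>t. q (t + of_int k))" by blast
    qed
  qed auto
  ultimately show ?thesis by metis
qed

end

context curve_lift
begin

text \<open>The range is open, and so is its complement, since through each point outside passes
  another lift with an open range disjoint from it. A connected clopen set is a component.\<close>

lemma range_component: "range q \<in> components (h -` \<gamma>)"
proof -
  have op: "openin (top_of_set (h -` \<gamma>)) (range q)"
    using lift_open_map[OF open_UNIV] .
  have "openin (top_of_set (h -` \<gamma>)) (h -` \<gamma> - range q)"
  proof (subst openin_subopen, intro ballI)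
    fix x assume x: "x \<in> h -` \<gamma> - range q"
    then obtain t where "h x = p t"
      using range_p by auto
    then obtain q' where q': "curve_lift p \<gamma> h q'" "q' t = x"
      using exists_lift[OF cov] by blast
    interpret q': curve_lift p \<gamma> h q' by fact
    have "range q' \<inter> range q = {}"
    proof (rule ccontr)
      assume "range q' \<inter> range q \<noteq> {}"
      then obtain x where "x \<in> range q'" "x \<in> range q" by blast
      then obtain s u where "q s = q' u" by (metis imageE)
      then have "range q = range q'"
        using lift_ranges[OF curve_lift_axioms q'(1)] by blast
      then show False
        using x q'(2) by auto
    qed
    then show "\<exists>T. openin (top_of_set (h -` \<gamma>)) T \<and> x \<in> T \<and> T \<subseteq> h -` \<gamma> - range q"
      using q'.lift_open_map[OF open_UNIV] q'(2)
      by (intro exI[of _ "range q'"]) (auto simp: q'.lift)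
  qed
  then have cl: "closedin (top_of_set (h -` \<gamma>)) (range q)"
    by (auto simp: closedin_def lift)
  have "D = range q" if D: "range q \<subseteq> D" "D \<subseteq> h -` \<gamma>" "connected D" for D
  proof -
    have "openin (top_of_set D) (range q)" "closedin (top_of_set D) (range q)"
      using op cl D openin_subset_trans closedin_subset_trans by blast+
    then show ?thesis
      using D(3) connected_clopen by blast
  qed
  moreover have "connected (range q)"
    using contq connected_continuous_image connected_UNIV by blast
  ultimately show ?thesis
    unfolding in_components_maximal by (auto simp: lift)
qed

text \<open>Integer shifts of \<open>q\<close> lift the same \<open>p\<close>, so agreement at one
  time spreads to all times: being a period does not depend on the base point.\<close>

lemma period_transfer:
  assumes "q (s + of_int k) = q (s + of_int l)"
  shows "q (t + of_int k) = q (t + of_int l)"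
  using fun_cong[OF lift_unique[OF shift shift assms]] .

text \<open>The evenly covered sets are images of open intervals of length \<open>1\<close>, on
  which \<open>p\<close> is injective. The sheets are the images of such an interval under the
  integer shifts of \<open>q\<close>.\<close>

lemma covering_range: "covering_space (range q) h \<gamma>"
proof
  show "continuous_on (range q) h"
    using conth by (rule continuous_on_subset) auto
  show "h ` range q = \<gamma>"
    using range_p by (simp add: image_image lift)
  fix y assume "y \<in> \<gamma>"
  then obtain t where t: "y = p t"
    using range_p by auto
  define J where "J = ball t (1/2)"
  have Jeq: "a = b" if ab: "a \<in> J" "b \<in> J" "p a = p b" for a b
  proof -
    obtain k :: int where k: "a - b = of_int k"
      using ab(3) p_eqE by blast
    have "\<bar>t - a\<bar> < 1/2" "\<bar>t - b\<bar> < 1/2"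
      using ab(1,2) by (auto simp: J_def dist_real_def)
    then have "\<bar>a - b\<bar> < 1"
      by linarith
    then have "k = 0"
      using k by linarith
    then show ?thesis using k by simp
  qed
  \<comment> \<open>Different indices give the same sheet when they differ by a period of
    \<open>q\<close>; the set \<open>range S\<close> merges these.\<close>
  define S where "S k = (\<lambda>t. q (t + of_int k)) ` J" for k
  have opS: "openin (top_of_set (range q)) (S k)" for k
  proof -
    interpret qk: curve_lift p \<gamma> h "\<lambda>t. q (t + of_int k)" by (rule shift)
    have "openin (top_of_set (h -` \<gamma>)) (S k)"
      unfolding S_def J_def by (rule qk.lift_open_map) auto
    then show ?thesis
      by (rule openin_subset_trans) (auto simp: S_def)
  qed
  have "\<Union>(range S) = range q \<inter> h -` (p ` J)"
  proof
    show "\<Union>(range S) \<subseteq> range q \<inter> h -` (p ` J)"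
      by (auto simp: S_def lift)
    show "range q \<inter> h -` (p ` J) \<subseteq> \<Union>(range S)"
    proof
      fix x assume "x \<in> range q \<inter> h -` (p ` J)"
      then obtain u v where u: "x = q u" "v \<in> J" "p u = p v"
        by (auto simp: lift)
      then obtain k :: int where "u - v = of_int k"
        using p_eqE by blast
      then have "x = q (v + of_int k)"
        using u by (simp add: algebra_simps)
      then show "x \<in> \<Union>(range S)"
        using u(2) by (auto simp: S_def)
    qed
  qed
  moreover have "pairwise disjnt (range S)"
  proof (rule pairwiseI)
    fix A B assume AB: "A \<in> range S" "B \<in> range S" "A \<noteq> B"
    then obtain k l where kl: "A = S k" "B = S l" by auto
    show "disjnt A B"
    proof (rule ccontr)
      assume "\<not> disjnt A B"
      then obtain a b where ab: "a \<in> J" "b \<in> J" "q (a + of_int k) = q (b + of_int l)"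
        by (auto simp: kl S_def disjnt_def)
      then have "p a = p b"
        using lift[of "a + of_int k"] lift[of "b + of_int l"] by simp
      then have "a = b"
        using Jeq ab by blast
      then have "S k = S l"
        unfolding S_def using period_transfer[of a k l] ab(3) by (intro image_cong) auto
      then show False
        using AB(3) kl by simp
    qed
  qed
  moreover have "\<exists>g. homeomorphism (S k) (p ` J) h g" for k
  proof -
    have "inj_on h (S k)"
      by (auto simp: inj_on_def S_def lift dest: Jeq)
    \<comment> \<open>\<open>h\<close> is open on the sheet because \<open>p\<close> is an open map;
      this makes the inverse continuous.\<close>
    moreover have "openin (top_of_set (p ` J)) (h ` W)" if "openin (top_of_set (S k)) W" for W
    proof -
      obtain V where V: "open V" "W = S k \<inter> V"
        using \<open>openin (top_of_set (S k)) W\<close> openin_open by blast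
      have "W = (\<lambda>t. q (t + of_int k)) ` (J \<inter> (\<lambda>t. q (t + of_int k)) -` V)"
        unfolding V(2) S_def by blast
      then have "h ` W = p ` (J \<inter> (\<lambda>t. q (t + of_int k)) -` V)"
        by (simp add: image_image lift)
      moreover have "open (J \<inter> (\<lambda>t. q (t + of_int k)) -` V)"
        unfolding J_def using curve_lift.contq[OF shift] V(1) 
        by (intro open_Int) (auto simp: continuous_on_open_vimage)
      ultimately have "openin (top_of_set \<gamma>) (h ` W)"
        using open_map by simp
      moreover have "h ` W \<subseteq> p ` J"
        unfolding V(2) S_def by (auto simp: lift)
      ultimately show ?thesis
        using openin_subset_trans[of \<gamma> "h ` W" "p ` J"] by (metis p_in image_subsetI)
    qed
    moreover have "continuous_on (S k) h"
      using conth by (rule continuous_on_subset) (auto simp: S_def)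
    moreover have "h ` S k = p ` J"
      by (simp add: S_def image_image lift)
    ultimately show ?thesis
      using homeomorphism_injective_open_map by metis
  qed
  moreover have "y \<in> p ` J" "openin (top_of_set \<gamma>) (p ` J)"
    using open_map[of J] by (auto simp: J_def t)
  ultimately show "\<exists>T. y \<in> T \<and> openin (top_of_set \<gamma>) T \<and>
     (\<exists>v. \<Union>v = range q \<inter> h -` T \<and> (\<forall>u\<in>v. openin (top_of_set (range q)) u) \<and>
        pairwise disjnt v \<and> (\<forall>u\<in>v. \<exists>g. homeomorphism u T h g))"
    using opS by (intro exI[of _ "p ` J"] conjI exI[of _ "range S"]) auto
qed

end

section \<open>Degree and least period of a lift\<close>

text \<open>Equal coincidences give a bijection of ranges. This compares the fibres over different
  points of \<gamma>.\<close>

lemma ecard_range_cong: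
  assumes "\<And>k l. f k = f l \<longleftrightarrow> g k = g l"
  shows "ecard (range f) = ecard (range g)"
proof -
  define b where "b x = g (inv f x)" for x
  have b: "b (f k) = g k" for k
    unfolding b_def using assms f_inv_into_f[of "f k" f UNIV] by blast
  have "bij_betw b (range f) (range g)"
    unfolding bij_betw_def inj_on_def using assms by (auto simp: b image_image)
  then show ?thesis
    unfolding ecard_def using bij_betw_finite bij_betw_same_card by metis
qed

lemma ecard_mono:
  assumes "A \<subseteq> B"
  shows "ecard A \<le> ecard B"
  using assms by (auto simp: ecard_def card_mono intro: finite_subset)

context curve_lift
begin

lemma fibre: "range q \<inter> h -` {p s} = range (\<lambda>k::int. q (s + of_int k))"
proof
  show "range q \<inter> h -` {p s} \<subseteq> range (\<lambda>k::int. q (s + of_int k))"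
  proof
    fix x assume "x \<in> range q \<inter> h -` {p s}"
    then obtain t where t: "x = q t" "p t = p s"
      by (auto simp: lift)
    then obtain k :: int where "t - s = of_int k"
      using p_eqE by blast
    then have "t = s + of_int k" by simp
    then show "x \<in> range (\<lambda>k::int. q (s + of_int k))"
      using t(1) by blast
  qed
qed (auto simp: lift)

text \<open>By \<open>period_transfer\<close> every fibre has the cardinality of the fibre over
  \<open>p 0\<close>, so the definite description in \<open>covering_degree\<close> denotes
  it.\<close>

lemma covering_degree_range: "covering_degree (range q) h \<gamma> = ecard (range (\<lambda>k::int. q (of_int k)))"
proof -
  have "ecard (range q \<inter> h -` {p s}) = ecard (range (\<lambda>k::int. q (of_int k)))" for s
    unfolding fibre
  proof (rule ecard_range_cong)
    fix k l :: int
    show "q (s + of_int k) = q (s + of_int l) \<longleftrightarrow> q (of_int k) = q (of_int l)"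
      using period_transfer[of 0 k l s] period_transfer[of s k l 0] by auto
  qed
  then have H: "\<forall>y\<in>\<gamma>. ecard (range q \<inter> h -` {y}) = ecard (range (\<lambda>k::int. q (of_int k)))"
    using range_p by auto
  show ?thesis
    unfolding covering_degree_def
  proof (rule the_equality)
    show "\<forall>y\<in>\<gamma>. ecard (range q \<inter> h -` {y}) = ecard (range (\<lambda>k::int. q (of_int k)))"
      by (rule H)
    fix d assume "\<forall>y\<in>\<gamma>. ecard (range q \<inter> h -` {y}) = d"
    from bspec[OF this p_in[of 0]] bspec[OF H p_in[of 0]]
    show "d = ecard (range (\<lambda>k::int. q (of_int k)))"
      by simp
  qed
qed

lemma inj_on_no_period:
  assumes "\<And>k. \<lbrakk>0 < k; k < d\<rbrakk> \<Longrightarrow> q (real k) \<noteq> q 0"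
  shows "inj_on (\<lambda>k::int. q (of_int k)) {0..<int d}"
proof (rule linorder_inj_onI)
  fix k l :: int assume kl: "k < l" "k \<in> {0..<int d}" "l \<in> {0..<int d}"
  show "q (of_int k) \<noteq> q (of_int l)"
  proof
    assume "q (of_int k) = q (of_int l)"
    then have "q (- of_int k + of_int k) = q (- of_int k + of_int l)"
      using period_transfer[of 0 k l "- of_int k"] by simp
    then have "q (real (nat (l - k))) = q 0"
      using kl by simp
    then show False
      using assms[of "nat (l - k)"] kl by (simp add: nat_less_iff)
  qed
qed auto

lemma covering_degree_ge:
  assumes "\<And>k. \<lbrakk>0 < k; k < d\<rbrakk> \<Longrightarrow> q (real k) \<noteq> q 0"
  shows "enat d \<le> covering_degree (range q) h \<gamma>"
proof -
  have "enat d = ecard ((\<lambda>k::int. q (of_int k)) ` {0..<int d})"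
    using inj_on_no_period[OF assms] by (simp add: ecard_def card_image)
  also have "\<dots> \<le> ecard (range (\<lambda>k::int. q (of_int k)))"
    by (intro ecard_mono) auto
  finally show ?thesis
    by (simp add: covering_degree_range)
qed

lemma minimal_period:
  assumes "k > 0" "q (real k) = q 0"
  obtains d where "d > 0" "q (real d) = q 0" "\<And>k. \<lbrakk>0 < k; k < d\<rbrakk> \<Longrightarrow> q (real k) \<noteq> q 0"
proof -
  have ex: "\<exists>k. 0 < k \<and> q (real k) = q 0"
    using assms by blast
  define d where "d = (LEAST k. 0 < k \<and> q (real k) = q 0)"
  have "0 < d \<and> q (real d) = q 0"
    unfolding d_def by (rule LeastI_ex[OF ex])
  then have d: "0 < d" "q (real d) = q 0"
    by simp_all
  have "q (real k) \<noteq> q 0" if "0 < k" "k < d" for k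
    using not_less_Least[OF \<open>k < d\<close>[unfolded d_def]] that(1) by simp
  then show ?thesis
    by (rule that[OF d])
qed

text \<open>Without a positive period, \<open>covering_degree_ge\<close> would put the degree above
  every natural number.\<close>

lemma exists_period:
  assumes "covering_degree (range q) h \<gamma> \<noteq> \<infinity>"
  obtains d where "d > 0" "q (real d) = q 0" "\<And>k. \<lbrakk>0 < k; k < d\<rbrakk> \<Longrightarrow> q (real k) \<noteq> q 0"
proof -
  have "\<exists>k>0. q (real k) = q 0"
  proof (rule ccontr)
    assume no: "\<nexists>k. k > 0 \<and> q (real k) = q 0"
    have "enat d \<le> covering_degree (range q) h \<gamma>" for d
      by (rule covering_degree_ge) (use no in blast)
    then have ge: "enat d \<le> covering_degree (range q) h \<gamma>" for d .
    obtain e where "covering_degree (range q) h \<gamma> = enat e"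
      using assms by auto
    then show False
      using ge[of "Suc e"] by simp
  qed
  then show ?thesis
    using minimal_period that by blast
qed

lemma periodic:
  assumes "q (real d) = q 0"
  shows "q (t + of_int (m * int d)) = q t"
proof -
  have per: "q (t + real d) = q t" for t
    using period_transfer[of 0 "int d" 0 t] assms by simp
  show ?thesis
  proof (induction m arbitrary: t rule: int_induct[of _ 0])
    case base then show ?case by simp
  next
    case (step1 i)
    have "q (t + of_int ((i + 1) * int d)) = q ((t + of_int (i * int d)) + real d)"
      by (simp add: algebra_simps)
    then show ?case using per step1 by simp
  next
    case (step2 i)
    have "q (t + of_int ((i - 1) * int d) + real d) = q (t + of_int (i * int d))"
      by (simp add: algebra_simps)
    then show ?case using per step2 by simp
  qed
qed

lemma periodic_range:
  assumes "d > 0" "q (real d) = q 0"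
  shows "range q = q ` {0..real d}"
proof
  show "range q \<subseteq> q ` {0..real d}"
  proof
    fix x assume "x \<in> range q"
    then obtain t where t: "x = q t" by blast
    let ?m = "\<lfloor>t / real d\<rfloor>"
    have "q (t + of_int (- ?m * int d)) = x"
      using periodic[OF assms(2)] t by blast
    moreover have "real_of_int ?m * real d \<le> t" "t \<le> (real_of_int ?m + 1) * real d"
      using assms(1) floor_divide_lower[of "real d" t] floor_divide_upper[of "real d" t] by auto
    then have "t + of_int (- ?m * int d) \<in> {0..real d}"
      by (auto simp: algebra_simps)
    ultimately show "x \<in> q ` {0..real d}" by blast
  qed
qed auto

text \<open>Reduction modulo \<open>d\<close> shows that the residues exhaust the fibre; minimality
  of \<open>d\<close> keeps them apart.\<close>

lemma covering_degree_eq: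
  assumes "d > 0" "q (real d) = q 0" "\<And>k. \<lbrakk>0 < k; k < d\<rbrakk> \<Longrightarrow> q (real k) \<noteq> q 0"
  shows "covering_degree (range q) h \<gamma> = enat d"
proof -
  have "range (\<lambda>k::int. q (of_int k)) = (\<lambda>k::int. q (of_int k)) ` {0..<int d}"
  proof
    show "range (\<lambda>k::int. q (of_int k)) \<subseteq> (\<lambda>k::int. q (of_int k)) ` {0..<int d}"
    proof
      fix x assume "x \<in> range (\<lambda>k::int. q (of_int k))"
      then obtain k :: int where k: "x = q (of_int k)" by blast
      have "q (of_int (k mod int d) + of_int (k div int d * int d)) = q (of_int (k mod int d))"
        by (rule periodic[OF assms(2)])
      moreover have "real_of_int (k mod int d) + of_int (k div int d * int d) = of_int k"
        by (metis mod_mult_div_eq mult.commute of_int_add)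
      ultimately have "x = q (of_int (k mod int d))"
        using k by simp
      moreover have "k mod int d \<in> {0..<int d}"
        using assms(1) by simp
      ultimately show "x \<in> (\<lambda>k::int. q (of_int k)) ` {0..<int d}" by blast
    qed
  qed auto
  then show ?thesis
    using inj_on_no_period[OF assms(3)] by (simp add: covering_degree_range ecard_def card_image)
qed

lemma covering_degree_infinite_imp:
  assumes "covering_degree (range q) h \<gamma> = \<infinity>" "k > 0"
  shows "q (real k) \<noteq> q 0"
proof
  assume "q (real k) = q 0"
  then obtain d where "d > 0" "q (real d) = q 0" "\<And>k. \<lbrakk>0 < k; k < d\<rbrakk> \<Longrightarrow> q (real k) \<noteq> q 0"
    using minimal_period[OF assms(2)] by blast
  then have "covering_degree (range q) h \<gamma> = enat d"
    by (rule covering_degree_eq)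
  then show False
    using assms(1) by simp
qed

text \<open>The loop is \<open>q\<close> on one period, rescaled to the unit interval. A coincidence
  has an integral time difference \<open>m\<close> with \<open>0 < m \<le> d\<close>, which is then
  a period, so \<open>m = d\<close> and only the end points coincide.\<close>

lemma simple_closed_curve_range:
  assumes "d > 0" "q (real d) = q 0" "\<And>k. \<lbrakk>0 < k; k < d\<rbrakk> \<Longrightarrow> q (real k) \<noteq> q 0"
  shows "simple_closed_curve (range q)"
proof -
  define c where "c x = q (real d * x)" for x
  have loop: "y = 0 \<and> x = 1" if xy: "y < x" "0 \<le> y" "x \<le> 1" "c x = c y" for x y
  proof -
    have "p (real d * x) = p (real d * y)"
      using arg_cong[OF xy(4), of h] by (simp add: c_def lift)
    then obtain m :: int where m: "real d * x - real d * y = of_int m"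
      using p_eqE by blast
    have "real d * x - real d * y > 0" "real d * x - real d * y \<le> real d * (1 - y)"
      using xy assms(1) by (auto simp: algebra_simps)
    then have m1: "real_of_int m > 0" "real_of_int m \<le> real d * (1 - y)"
      using m by auto
    then have "real_of_int m \<le> real d"
      using mult_left_le[of "1 - y" "real d"] xy(2) by linarith
    have "q (real d * y + of_int m) = q (real d * y + of_int 0)"
      using xy(4) m by (simp add: c_def algebra_simps)
    then have "q (0 + of_int m) = q (0 + of_int 0)"
      by (rule period_transfer)
    then have "q (real (nat m)) = q 0"
      using m1 by simp
    then have "\<not> nat m < d"
      using assms(3)[of "nat m"] m1 by auto
    then have "int d \<le> m"
      using m1(1) by (simp add: not_less le_nat_iff)
    then have md: "real_of_int m = real d"
      using \<open>real_of_int m \<le> real d\<close> by linarith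
    then have "y = 0"
      using m1(2) xy(2) assms(1) by (auto simp: algebra_simps mult_le_0_iff)
    moreover have "x = 1"
      using m md \<open>y = 0\<close> assms(1) by simp
    ultimately show ?thesis by simp
  qed
  have "continuous_on {0..1} c"
    unfolding c_def by (intro continuous_on_compose2[OF contq] continuous_intros) auto
  moreover have "loop_free c"
    unfolding loop_free_def using loop by (metis atLeastAtMost_iff linorder_neqE)
  ultimately have "simple_path c"
    by (simp add: simple_path_def path_def)
  moreover have "pathfinish c = pathstart c"
    using assms(2) by (simp add: pathfinish_def pathstart_def c_def)
  moreover have "path_image c = range q"
  proof -
    have "(*) (real d) ` {0..1} = {0..real d}"
      using assms(1) by (simp add: image_mult_atLeastAtMost)
    then show ?thesis
      unfolding path_image_def c_def periodic_range[OF assms(1,2)] by (metis image_image)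
  qed
  ultimately show ?thesis
    unfolding simple_closed_curve_def by metis
qed

text \<open>Finite degree makes the range the image of a compact interval. Conversely, an infinite
  fibre in a bounded range would give the non-constant map \<open>h - p 0\<close> infinitely many
  zeros in a compact set.\<close>

lemma covering_degree_infinite_iff:
  assumes "h holomorphic_on UNIV" "\<not> h constant_on UNIV"
  shows "covering_degree (range q) h \<gamma> = \<infinity> \<longleftrightarrow> \<not> bounded (range q)"
proof
  assume "\<not> bounded (range q)"
  show "covering_degree (range q) h \<gamma> = \<infinity>"
  proof (rule ccontr)
    assume "covering_degree (range q) h \<gamma> \<noteq> \<infinity>"
    then obtain d where "d > 0" "q (real d) = q 0"
      using exists_period by blast
    then have "range q = q ` {0..real d}"
      by (rule periodic_range)
    moreover have "compact (q ` {0..real d})"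
      using contq continuous_on_subset by (intro compact_continuous_image) auto
    ultimately show False
      using \<open>\<not> bounded (range q)\<close> compact_imp_bounded by metis
  qed
next
  assume inf: "covering_degree (range q) h \<gamma> = \<infinity>"
  show "\<not> bounded (range q)"
  proof
    assume "bounded (range q)"
    then have "compact (closure (range q))"
      by simp
    moreover have "\<not> (\<lambda>z. h z - p 0) constant_on UNIV"
      using assms(2) by (auto simp: constant_on_def algebra_simps)
    ultimately have "finite {z \<in> closure (range q). h z - p 0 = 0}"
      using assms(1) by (intro holomorphic_compact_finite_zeros[of _ UNIV]) (auto intro: holomorphic_intros)
    moreover have "range (\<lambda>k::int. q (of_int k)) \<subseteq> {z \<in> closure (range q). h z - p 0 = 0}"
      using p_shift[of 0] by (auto simp: lift intro!: closure_subset[THEN subsetD])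
    ultimately show False
      using inf finite_subset by (auto simp: covering_degree_range ecard_def split: if_splits)
  qed
qed

end

section \<open>Stability of lifts\<close>

text \<open>The point is a radius independent of \<open>n\<close>. Injectivity of \<open>g\<close>
  makes \<open>a = deriv g z\<close> non-zero, and for large \<open>n\<close>
  \<open>deriv (gs n)\<close> stays within \<open>norm a / 2\<close> of \<open>a\<close> on the
  disc. So \<open>gs n\<close> differs from multiplication by \<open>a\<close> by a map with
  Lipschitz constant \<open>norm a / 2\<close>.\<close>

lemma eventually_inj_on_ball:
  assumes hol: "\<And>n. gs n holomorphic_on UNIV" "g holomorphic_on UNIV"
    and conv: "converges_locally_uniformly gs g"
    and V: "open V" "z \<in> V" "inj_on g V"
  obtains \<rho> where "\<rho> > 0" "\<forall>\<^sub>F n in sequentially. inj_on (gs n) (ball z \<rho>)"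
proof -
  define a where "a = deriv g z"
  have a: "norm a > 0"
    using holomorphic_injective_imp_regular[OF holomorphic_on_subset[OF hol(2)] V(1,3,2)] by (simp add: a_def)
  have "isCont (deriv g) z"
    using holomorphic_deriv[OF hol(2) open_UNIV] holomorphic_on_imp_continuous_on continuous_on_interior[of UNIV]
    by (metis UNIV_I interior_UNIV)
  then obtain \<rho> where \<rho>: "\<rho> > 0" "\<And>w. dist w z < \<rho> \<Longrightarrow> dist (deriv g w) a < norm a / 4"
    using a unfolding continuous_at_eps_delta a_def by (metis divide_pos_pos zero_less_numeral)
  \<comment> \<open>The Cauchy inequality on discs of radius \<rho> turns \<open>e\<close> into the
    bound \<open>norm a / 4\<close> for the derivative of \<open>gs n - g\<close>. Such discs
    centred in \<open>ball z \<rho>\<close> lie in \<open>cball z (2 * \<rho>)\<close>.\<close>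
  define e where "e = \<rho> * norm a / 4"
  have e: "e > 0"
    using a \<rho>(1) by (simp add: e_def)
  have "\<forall>\<^sub>F n in sequentially. \<forall>w\<in>cball z (2 * \<rho>). dist (gs n w) (g w) < e"
    using uniform_limitD[OF converges_locally_uniformly_compact[OF conv compact_cball] e] .
  then have "\<forall>\<^sub>F n in sequentially. inj_on (gs n) (ball z \<rho>)"
  proof eventually_elim
    case (elim n)
    have dif: "f field_differentiable at w" if "f holomorphic_on UNIV" for f and w :: complex
      using holomorphic_on_imp_differentiable_at[OF that] by simp
    have der: "norm (deriv (gs n) w - a) \<le> norm a / 2" if w: "w \<in> ball z \<rho>" for w
    proof -
      have "cmod ((deriv ^^ 1) (\<lambda>x. gs n x - g x) w) \<le> fact 1 * e / \<rho> ^ 1"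
      proof (rule Cauchy_inequality)
        show "(\<lambda>x. gs n x - g x) holomorphic_on ball w \<rho>"
          by (intro holomorphic_on_diff holomorphic_on_subset[OF hol(1)] holomorphic_on_subset[OF hol(2)]) auto
        show "continuous_on (cball w \<rho>) (\<lambda>x. gs n x - g x)"
          by (intro holomorphic_on_imp_continuous_on holomorphic_on_diff holomorphic_on_subset[OF hol(1)] holomorphic_on_subset[OF hol(2)]) auto
        fix x assume "cmod (w - x) = \<rho>"
        then have "dist z x \<le> 2 * \<rho>"
          using w dist_triangle[of z x w] by (simp add: dist_norm)
        then show "cmod (gs n x - g x) \<le> e"
          using elim[rule_format, of x] by (simp add: dist_norm)
      qed (use \<rho> in auto)
      then have "cmod (deriv (\<lambda>x. gs n x - g x) w) \<le> norm a / 4"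
        using \<rho>(1) by (simp add: e_def)
      then have "cmod (deriv (gs n) w - deriv g w) \<le> norm a / 4"
        using deriv_diff[OF dif[OF hol(1)] dif[OF hol(2)]] by metis
      moreover have "cmod (deriv g w - a) < norm a / 4"
        using \<rho>(2)[of w] w by (simp add: dist_norm norm_minus_commute)
      ultimately show ?thesis
        using norm_triangle_ineq[of "deriv (gs n) w - deriv g w" "deriv g w - a"] by simp
    qed
    show ?case
    proof (rule inj_onI)
      fix x y assume xy: "x \<in> ball z \<rho>" "y \<in> ball z \<rho>" "gs n x = gs n y"
      have "cmod ((gs n x - a * x) - (gs n y - a * y)) \<le> norm a / 2 * norm (x - y)"
      proof (rule field_differentiable_bound[where S="ball z \<rho>" and f'="\<lambda>w. deriv (gs n) w - a"])
        fix w assume "w \<in> ball z \<rho>"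
        have "(gs n has_field_derivative deriv (gs n) w) (at w)"
          using dif[OF hol(1)] by (simp add: DERIV_deriv_iff_field_differentiable)
        then have "((\<lambda>w. gs n w - a * w) has_field_derivative deriv (gs n) w - a) (at w)"
          by (auto intro!: derivative_eq_intros)
        then show "((\<lambda>w. gs n w - a * w) has_field_derivative deriv (gs n) w - a) (at w within ball z \<rho>)"
          by (rule has_field_derivative_at_within)
      qed (use der xy in auto)
      also have "(gs n x - a * x) - (gs n y - a * y) = - (a * (x - y))"
        using xy(3) by (simp add: algebra_simps)
      finally have "norm a * norm (x - y) \<le> norm a / 2 * norm (x - y)"
        by (simp add: norm_mult)
      then have "norm a * norm (x - y) \<le> 0"
        by simp
      then show "x = y"
        using a by (simp add: mult_le_0_iff)
    qed
  qed
  then show ?thesis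
    using that \<rho>(1) by blast
qed

text \<open>Hurwitz: if \<open>gs n - g z\<close> had no zero in the disc for infinitely many
  \<open>n\<close>, neither would the limit, which vanishes at \<open>z\<close>.\<close>

lemma eventually_solvable:
  assumes hol: "\<And>n. gs n holomorphic_on UNIV" "g holomorphic_on UNIV" and nc: "\<not> g constant_on UNIV"
    and conv: "converges_locally_uniformly gs g" and e: "e > 0"
  shows "\<forall>\<^sub>F n in sequentially. \<exists>w\<in>ball z e. gs n w = g z"
proof (rule ccontr)
  let ?N = "{n. \<not> (\<exists>w\<in>ball z e. gs n w = g z)}"
  assume "\<not> ?thesis"
  then have "infinite ?N"
    unfolding cofinite_eq_sequentially[symmetric] eventually_cofinite .
  then obtain k :: "nat \<Rightarrow> nat" where k: "strict_mono k" "\<forall>n. k n \<in> ?N"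
    using infinite_enumerate[of ?N] by blast
  have "g z - g z \<noteq> 0"
  proof (rule Hurwitz_no_zeros[of "ball z e" "\<lambda>n w. gs (k n) w - g z" "\<lambda>w. g w - g z"])
    show "(\<lambda>w. gs (k n) w - g z) holomorphic_on ball z e" for n
      by (intro holomorphic_intros holomorphic_on_subset[OF hol(1)]) auto
    show "(\<lambda>w. g w - g z) holomorphic_on ball z e"
      by (intro holomorphic_intros holomorphic_on_subset[OF hol(2)]) auto
    show "uniform_limit K (\<lambda>n w. gs (k n) w - g z) (\<lambda>w. g w - g z) sequentially" if "compact K" for K
      using converges_locally_uniformly_compact[OF converges_locally_uniformly_subseq[OF conv k(1)] that]
      by (intro uniform_limit_intros) (simp add: comp_def)
    show "\<not> (\<lambda>w. g w - g z) constant_on ball z e"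
    proof
      assume "(\<lambda>w. g w - g z) constant_on ball z e"
      then obtain c where c: "\<And>w. w \<in> ball z e \<Longrightarrow> g w - g z = c"
        unfolding constant_on_def by blast
      have "g w = c + g z" for w
      proof (rule analytic_continuation_open[of "ball z e" UNIV g "\<lambda>_. c + g z"])
        show "g x = c + g z" if "x \<in> ball z e" for x
          using c[OF that] by (simp add: algebra_simps)
      qed (use hol(2) e in auto)
      then show False
        using nc unfolding constant_on_def by blast
    qed
    show "gs (k n) w - g z \<noteq> 0" if "w \<in> ball z e" for n w
      using k(2) that by auto
  qed (use e in auto)
  then show False
    by simp
qed

text \<open>For large \<open>n\<close> the distance from \<open>q' t\<close> to \<open>q t\<close> cannot lie in \<open>[\<eta>, \<delta>]\<close>, so by continuity it
  stays below \<open>\<eta>\<close> once it is at most \<open>\<delta>\<close>.\<close>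

lemma lifts_close:
  fixes q :: "real \<Rightarrow> complex"
  assumes conv: "converges_locally_uniformly gs g" and contg: "continuous_on UNIV g"
    and contq: "continuous_on UNIV q" and contp: "continuous_on UNIV p"
    and sep: "\<And>t w. \<lbrakk>t \<in> {-T..T}; dist w (q t) \<le> \<delta>; g w = p t\<rbrakk> \<Longrightarrow> w = q t"
    and pos: "\<delta> > 0" "\<eta> > 0"
  shows "\<forall>\<^sub>F n in sequentially. \<forall>q'. continuous_on UNIV q' \<and> (\<forall>t. gs n (q' t) = p t) \<and>
    (\<exists>t\<in>{-T..T}. dist (q' t) (q t) \<le> \<delta>) \<longrightarrow> (\<forall>t\<in>{-T..T}. dist (q' t) (q t) < \<eta>)"
proof -
  \<comment> \<open>For \<eta> above \<delta> the interval from \<eta> to \<delta> would be empty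
    and could not act as a barrier; hence the cap at \<delta>.\<close>
  define \<eta>' where "\<eta>' = min \<eta> \<delta>"
  have \<eta>': "\<eta>' > 0" "\<eta>' \<le> \<eta>" "\<eta>' \<le> \<delta>"
    using pos by (auto simp: \<eta>'_def)
  \<comment> \<open>A point of \<open>A\<close> is a time \<open>t\<close> and a displacement
    \<open>v\<close> in the annulus. By \<open>sep\<close> the value \<open>g (q t + v)\<close>
    differs from \<open>p t\<close> there, and compactness yields a uniform gap
    \<open>e\<close>.\<close>
  define A where "A = {-T..T} \<times> (cball (0::complex) \<delta> - ball 0 \<eta>')"
  have A: "compact A"
    unfolding A_def by (intro compact_Times compact_diff) auto
  have contF: "continuous_on A (\<lambda>x. norm (g (q (fst x) + snd x) - p (fst x)))"
    by (intro continuous_intros continuous_on_compose2[OF contg] continuous_on_compose2[OF contq]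
        continuous_on_compose2[OF contp]) auto
  have F: "norm (g (q (fst x) + snd x) - p (fst x)) > 0" if "x \<in> A" for x
  proof -
    obtain t v where x: "x = (t, v)" "t \<in> {-T..T}" "norm v \<le> \<delta>" "\<eta>' \<le> norm v"
      using \<open>x \<in> A\<close> by (cases x) (simp add: A_def)
    have "g (q t + v) \<noteq> p t"
    proof
      assume "g (q t + v) = p t"
      then have "q t + v = q t"
        by (intro sep x) (simp_all add: dist_norm x)
      then show False
        using x(4) \<eta>'(1) by simp
    qed
    then show ?thesis
      by (simp add: x)
  qed
  obtain e where e: "e > 0" "\<And>x. x \<in> A \<Longrightarrow> e \<le> norm (g (q (fst x) + snd x) - p (fst x))"
  proof (cases "A = {}")
    \<comment> \<open>This happens for \<open>T < 0\<close>; any positive \<open>e\<close>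
      serves.\<close>
    case True
    then show ?thesis
      using that[of 1] by simp
  next
    case False
    from continuous_attains_inf[OF A False contF]
    obtain x where "x \<in> A" "\<forall>y\<in>A. norm (g (q (fst x) + snd x) - p (fst x)) \<le> norm (g (q (fst y) + snd y) - p (fst y))"
      by blast
    then show ?thesis
      using that[OF F[of x]] by blast
  qed
  have "compact ((\<lambda>x. q (fst x) + snd x) ` A)"
    by (intro compact_continuous_image A continuous_intros continuous_on_compose2[OF contq]) auto
  from uniform_limitD[OF converges_locally_uniformly_compact[OF conv this] e(1)]
  show ?thesis
  proof eventually_elim
    case (elim n)
    show ?case
    proof (intro allI impI ballI)
      fix q' t
      assume q': "continuous_on UNIV q' \<and> (\<forall>t. gs n (q' t) = p t) \<and> (\<exists>t\<in>{-T..T}. dist (q' t) (q t) \<le> \<delta>)"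
        and t: "t \<in> {-T..T}"
      then obtain t1 where t1: "t1 \<in> {-T..T}" "dist (q' t1) (q t1) \<le> \<delta>"
        by blast
      have gap: "\<not> (\<eta>' \<le> dist (q' t) (q t) \<and> dist (q' t) (q t) \<le> \<delta>)" if "t \<in> {-T..T}" for t
      proof
        assume "\<eta>' \<le> dist (q' t) (q t) \<and> dist (q' t) (q t) \<le> \<delta>"
        then have x: "(t, q' t - q t) \<in> A"
          using \<open>t \<in> {-T..T}\<close> by (simp add: A_def dist_norm norm_minus_commute not_less)
        have "e \<le> norm (g (q' t) - p t)"
          using e(2)[OF x] by simp
        moreover have "dist (gs n (q' t)) (g (q' t)) < e"
          using elim[rule_format, OF imageI[OF x]] by simp
        then have "norm (g (q' t) - p t) < e"
          using q' by (simp add: dist_norm norm_minus_commute)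
        ultimately show False
          by simp
      qed
      have t1': "dist (q' t1) (q t1) < \<eta>'"
        using gap[OF t1(1)] t1(2) by simp
      show "dist (q' t) (q t) < \<eta>"
      proof (rule ccontr)
        assume "\<not> dist (q' t) (q t) < \<eta>"
        then have ge: "\<eta>' \<le> dist (q' t) (q t)"
          using \<eta>'(2) by simp
        have "continuous_on {-T..T} q'" "continuous_on {-T..T} q"
          using q' contq continuous_on_subset by blast+
        then have "connected ((\<lambda>t. dist (q' t) (q t)) ` {-T..T})"
          by (intro connected_continuous_image continuous_on_dist connected_Icc)
        then have "\<eta>' \<in> (\<lambda>t. dist (q' t) (q t)) ` {-T..T}"
          by (rule connectedD_interval[OF _ imageI[OF t1(1)] imageI[OF t]]) (use t1' ge in simp_all)
        then obtain u where "u \<in> {-T..T}" "\<eta>' = dist (q' u) (q u)"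
          by blast
        then show False
          using gap[of u] \<eta>'(3) by simp
      qed
    qed
  qed
qed

text \<open>\<delta> is half a Lebesgue number for a cover of the compact arc by open sets on which
  \<open>h\<close> is injective over \<gamma>.\<close>

lemma (in curve_lift) separation:
  obtains \<delta> where "\<delta> > 0" "\<And>t w. \<lbrakk>t \<in> {-T..T}; dist w (q t) \<le> \<delta>; h w = p t\<rbrakk> \<Longrightarrow> w = q t"
proof -
  let ?G = "{V. open V \<and> inj_on h (h -` \<gamma> \<inter> V)}"
  have "compact (q ` {-T..T})"
    by (intro compact_continuous_image continuous_on_subset[OF contq]) auto
  moreover have "q ` {-T..T} \<subseteq> \<Union>?G"
  proof
    fix x assume "x \<in> q ` {-T..T}"
    then obtain t where t: "x = q t"
      by blast
    obtain S U k where S: "q t \<in> S" "openin (top_of_set (h -` \<gamma>)) S" "homeomorphism S U h k"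
      using covering_space_local_homeomorphism[OF cov, of "q t"] by (metis q_in vimageI)
    obtain V where V: "open V" "S = h -` \<gamma> \<inter> V"
      using S(2) openin_open by blast
    have "inj_on h S"
      using S(3) by (metis homeomorphism_apply1 inj_on_inverseI)
    then show "x \<in> \<Union>?G"
      using V S(1) t by auto
  qed
  ultimately obtain e where e: "e > 0" "\<And>x. x \<in> q ` {-T..T} \<Longrightarrow> \<exists>V\<in>?G. ball x e \<subseteq> V"
    using Heine_Borel_lemma[of "q ` {-T..T}" ?G] by (metis (no_types, lifting) mem_Collect_eq)
  have "w = q t" if t: "t \<in> {-T..T}" and w: "dist w (q t) \<le> e / 2" "h w = p t" for t w
  proof -
    obtain V where V: "inj_on h (h -` \<gamma> \<inter> V)" "ball (q t) e \<subseteq> V"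
      using e(2)[OF imageI[OF t]] by blast
    have "w \<in> V" "q t \<in> V"
      using V(2) w(1) e(1) by (auto simp: dist_commute)
    then show ?thesis
      using inj_onD[OF V(1), of w "q t"] w(2) by (simp add: lift)
  qed
  then show ?thesis
    using that[of "e / 2"] e(1) by simp
qed

section \<open>Lifts through the approximating maps\<close>

text \<open>\<open>Q n\<close> starts at a solution near \<open>q 0\<close> of
  \<open>gs n w = p 0\<close>. A lift through any other point over \<gamma> within \<epsilon> of
  \<open>q 0\<close> is close to \<open>q\<close> at a small time, hence at time \<open>0\<close>,
  where injectivity of \<open>gs n\<close> makes it equal to \<open>Q n\<close>.\<close>

lemma approximating_lifts:
  assumes q: "curve_lift p \<gamma> g q"
    and hol: "\<And>n. gs n holomorphic_on UNIV" "g holomorphic_on UNIV" and nc: "\<not> g constant_on UNIV"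
    and conv: "converges_locally_uniformly gs g"
    and cov: "\<forall>\<^sub>F n in sequentially. covering_space (gs n -` \<gamma>) (gs n) \<gamma>"
    and V: "open V" "q 0 \<in> V" "inj_on g V"
  obtains \<epsilon> \<rho> Q where "\<epsilon> > 0" "\<rho> > 0"
    "\<forall>\<^sub>F n in sequentially. inj_on (gs n) (ball (q 0) \<rho>)"
    "\<forall>\<^sub>F n in sequentially. curve_lift p \<gamma> (gs n) (Q n) \<and> dist (q 0) (Q n 0) < \<epsilon> \<and>
       (\<forall>u. gs n u \<in> \<gamma> \<and> dist (q 0) u < \<epsilon> \<longrightarrow> u \<in> range (Q n))"
    "\<And>T \<eta>. \<eta> > 0 \<Longrightarrow> \<forall>\<^sub>F n in sequentially. \<forall>t\<in>{-T..T}. dist (Q n t) (q t) < \<eta>"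
proof -
  interpret q: curve_lift p \<gamma> g q by fact
  have contg: "continuous_on UNIV g"
    using hol(2) holomorphic_on_imp_continuous_on by blast
  obtain \<rho> where \<rho>: "\<rho> > 0" "\<forall>\<^sub>F n in sequentially. inj_on (gs n) (ball (q 0) \<rho>)"
    using eventually_inj_on_ball[OF hol conv V] by blast
  obtain \<delta> where \<delta>: "\<delta> > 0" "\<And>t w. \<lbrakk>t \<in> {-1..1}; dist w (q t) \<le> \<delta>; g w = p t\<rbrakk> \<Longrightarrow> w = q t"
    using q.separation[of 1] by blast
  have "isCont q 0"
    using q.contq by (simp add: continuous_on_eq_continuous_at)
  then obtain \<tau>0 where \<tau>0: "\<tau>0 > 0" "\<And>t. dist t 0 < \<tau>0 \<Longrightarrow> dist (q t) (q 0) < \<delta> / 2"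
    using \<delta>(1) unfolding continuous_at_eps_delta by (metis half_gt_zero)
  \<comment> \<open>Within time \<tau> the curve \<open>q\<close> moves less than
    \<open>\<delta> / 2\<close>, and points of \<gamma> within \<open>r\<close> of
    \<open>p 0\<close> are reached within that time. Below, \<open>g\<close> maps the
    \<epsilon>-disc to within \<open>r / 2\<close> of \<open>p 0\<close>; the other
    \<open>r / 2\<close> is left for \<open>gs n - g\<close>.\<close>
  define \<tau> where "\<tau> = min 1 \<tau>0"
  have \<tau>: "\<tau> > 0"
    using \<tau>0(1) by (simp add: \<tau>_def)
  obtain r where r: "r > 0" "\<And>y. \<lbrakk>y \<in> \<gamma>; dist (p 0) y < r\<rbrakk> \<Longrightarrow> \<exists>t'. \<bar>t' - 0\<bar> < \<tau> \<and> p t' = y"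
    using q.locally_onto[OF \<tau>, of 0] by blast
  have "isCont g (q 0)"
    using contg by (simp add: continuous_on_eq_continuous_at)
  then obtain \<epsilon>0 where \<epsilon>0: "\<epsilon>0 > 0" "\<And>w. dist w (q 0) < \<epsilon>0 \<Longrightarrow> dist (g w) (p 0) < r / 2"
    using r(1) q.lift[of 0] unfolding continuous_at_eps_delta by (metis half_gt_zero)
  define \<epsilon> where "\<epsilon> = min (\<delta> / 2) \<epsilon>0"
  have \<epsilon>: "\<epsilon> > 0" "\<epsilon> \<le> \<delta> / 2" "\<epsilon> \<le> \<epsilon>0"
    using \<delta>(1) \<epsilon>0(1) by (auto simp: \<epsilon>_def)
  define \<sigma> where "\<sigma> = min \<rho> \<epsilon>"
  have \<sigma>: "\<sigma> > 0" "\<sigma> \<le> \<rho>" "\<sigma> \<le> \<epsilon>"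
    using \<rho>(1) \<epsilon>(1) by (auto simp: \<sigma>_def)
  have r2: "r / 2 > 0"
    using r(1) by simp
  \<comment> \<open>The choice is meaningful once such a lift exists, which holds for all large
    \<open>n\<close>.\<close>
  define Q where "Q n = (SOME q'. curve_lift p \<gamma> (gs n) q' \<and> dist (q' 0) (q 0) < \<sigma>)" for n
  have close: "\<forall>\<^sub>F n in sequentially. \<forall>q'. continuous_on UNIV q' \<and> (\<forall>t. gs n (q' t) = p t) \<and>
    (\<exists>t\<in>{-1..1}. dist (q' t) (q t) \<le> \<delta>) \<longrightarrow> (\<forall>t\<in>{-1..1}. dist (q' t) (q t) < \<eta>)" if "\<eta> > 0" for \<eta>
    by (rule lifts_close[OF conv contg q.contq q.cont \<delta>(2,1) that])
  have Q: "\<forall>\<^sub>F n in sequentially. curve_lift p \<gamma> (gs n) (Q n) \<and> dist (Q n 0) (q 0) < \<sigma>"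
    using cov eventually_solvable[OF hol nc conv \<sigma>(1), of "q 0"]
  proof eventually_elim
    case (elim n)
    from elim(2) obtain w where w: "dist (q 0) w < \<sigma>" "gs n w = p 0"
      using q.lift[of 0] by auto
    obtain q' where "curve_lift p \<gamma> (gs n) q'" "q' 0 = w"
      using q.exists_lift[OF elim(1) w(2)] by blast
    then have "\<exists>q'. curve_lift p \<gamma> (gs n) q' \<and> dist (q' 0) (q 0) < \<sigma>"
      using w(1) dist_commute by metis
    then show ?case
      unfolding Q_def by (rule someI_ex)
  qed
  have uniq: "\<forall>\<^sub>F n in sequentially. \<forall>u. gs n u \<in> \<gamma> \<and> dist (q 0) u < \<epsilon> \<longrightarrow> u \<in> range (Q n)"
    using Q cov \<rho>(2) close[OF \<sigma>(1)]
      uniform_limitD[OF converges_locally_uniformly_compact[OF conv compact_cball[of "q 0" \<epsilon>]] r2]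
  proof eventually_elim
    case (elim n)
    show ?case
    proof (intro allI impI)
      fix u assume u: "gs n u \<in> \<gamma> \<and> dist (q 0) u < \<epsilon>"
      have "dist (gs n u) (g u) < r / 2"
        using elim(5)[rule_format, of u] u by simp
      moreover have "dist (g u) (p 0) < r / 2"
        using \<epsilon>0(2)[of u] u \<epsilon>(3) by (simp add: dist_commute)
      ultimately have "dist (gs n u) (p 0) < r / 2 + r / 2"
        using dist_triangle[of "gs n u" "p 0" "g u"] by linarith
      then have "dist (p 0) (gs n u) < r"
        by (simp add: dist_commute)
      then obtain t where t: "\<bar>t\<bar> < \<tau>" "p t = gs n u"
        using r(2)[of "gs n u"] u by auto
      obtain q' where q': "curve_lift p \<gamma> (gs n) q'" "q' t = u"
        using q.exists_lift[OF elim(2), of u t] t(2) by metis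
      interpret q': curve_lift p \<gamma> "gs n" q' by (rule q'(1))
      have t1: "t \<in> {-1..1}"
        using t(1) by (simp add: \<tau>_def abs_less_iff)
      have "dist (q t) (q 0) < \<delta> / 2"
        using \<tau>0(2)[of t] t(1) by (simp add: \<tau>_def)
      then have "dist (q' t) (q t) < \<delta> / 2 + \<delta> / 2"
        using dist_triangle[of u "q t" "q 0"] u \<epsilon>(2) unfolding q'(2) dist_commute[of u "q 0"] dist_commute[of "q 0" "q t"]
        by linarith
      then have "\<exists>t\<in>{-1..1}. dist (q' t) (q t) \<le> \<delta>"
        by (intro bexI[OF _ t1]) simp
      then have "\<forall>t\<in>{-1..1}. dist (q' t) (q t) < \<sigma>"
        using elim(4) q'.contq q'.lift by blast
      then have "dist (q' 0) (q 0) < \<sigma>"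
        by simp
      then have "q' 0 \<in> ball (q 0) \<rho>" "Q n 0 \<in> ball (q 0) \<rho>"
        using elim(1) \<sigma>(2) by (simp_all add: dist_commute)
      moreover have "gs n (q' 0) = gs n (Q n 0)"
        using q'.lift[of 0] curve_lift.lift[of p \<gamma> "gs n" "Q n" 0] elim(1) by simp
      ultimately have "q' 0 = Q n 0"
        using inj_onD[OF elim(3)] by metis
      then have "q' = Q n"
        using q.lift_unique[OF q'(1)] elim(1) by blast
      then show "u \<in> range (Q n)"
        using q'(2) by blast
    qed
  qed
  \<comment> \<open>Convergence at time \<open>0\<close> comes first: the constant
    \<open>\<delta>'\<close> below depends on \<open>T\<close> and may be smaller than
    \<sigma>.\<close>
  have lim0: "\<forall>\<^sub>F n in sequentially. dist (Q n 0) (q 0) < \<eta>" if "\<eta> > 0" for \<eta>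
    using Q close[OF that]
  proof eventually_elim
    case (elim n)
    interpret Q: curve_lift p \<gamma> "gs n" "Q n" using elim(1) by simp
    have "dist (Q n 0) (q 0) \<le> \<delta>"
      using elim(1) \<sigma>(3) \<epsilon>(2) \<delta>(1) by linarith
    then have "\<exists>t\<in>{-1..1}. dist (Q n t) (q t) \<le> \<delta>"
      by (intro bexI[of _ 0]) simp_all
    then have "\<forall>t\<in>{-1..1}. dist (Q n t) (q t) < \<eta>"
      using elim(2) Q.contq Q.lift by blast
    then show ?case by simp
  qed
  have lim: "\<forall>\<^sub>F n in sequentially. \<forall>t\<in>{-T..T}. dist (Q n t) (q t) < \<eta>" if "\<eta> > 0" for T \<eta>
  proof (cases "T \<ge> 0")
    case True
    obtain \<delta>' where \<delta>': "\<delta>' > 0" "\<And>t w. \<lbrakk>t \<in> {-T..T}; dist w (q t) \<le> \<delta>'; g w = p t\<rbrakk> \<Longrightarrow> w = q t"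
      using q.separation[of T] by blast
    have "\<forall>\<^sub>F n in sequentially. \<forall>q'. continuous_on UNIV q' \<and> (\<forall>t. gs n (q' t) = p t) \<and>
      (\<exists>t\<in>{-T..T}. dist (q' t) (q t) \<le> \<delta>') \<longrightarrow> (\<forall>t\<in>{-T..T}. dist (q' t) (q t) < \<eta>)"
      by (rule lifts_close[OF conv contg q.contq q.cont \<delta>'(2,1) that])
    with Q lim0[OF \<delta>'(1)] show ?thesis
    proof eventually_elim
      case (elim n)
      interpret Q: curve_lift p \<gamma> "gs n" "Q n" using elim(1) by simp
      have "\<exists>t\<in>{-T..T}. dist (Q n t) (q t) \<le> \<delta>'"
        using elim(2) True by (intro bexI[of _ 0]) simp_all
      then show ?case
        using elim(3) Q.contq Q.lift by blast
    qed
  qed simp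
  show ?thesis
  proof (rule that[OF \<epsilon>(1) \<rho> _ lim])
    show "\<forall>\<^sub>F n in sequentially. curve_lift p \<gamma> (gs n) (Q n) \<and> dist (q 0) (Q n 0) < \<epsilon> \<and>
       (\<forall>u. gs n u \<in> \<gamma> \<and> dist (q 0) u < \<epsilon> \<longrightarrow> u \<in> range (Q n))"
      using Q uniq
    proof eventually_elim
      case (elim n)
      have "dist (q 0) (Q n 0) < \<epsilon>"
        using elim(1) \<sigma>(3) by (simp add: dist_commute)
      then show ?case
        using elim by blast
    qed
  qed
qed

section \<open>Components near a given point\<close>

lemma components_eq_if_common_point:
  assumes "C \<in> components S" "D \<in> components S" "x \<in> C" "x \<in> D"
  shows "C = D"
  using assms components_nonoverlap by blast

text \<open>\<open>infdist z {}\<close> is \<open>0\<close>, hence the assumption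
  \<open>C \<noteq> {}\<close>.\<close>

lemma infdist_lessE:
  assumes "infdist z C < e" "C \<noteq> {}"
  obtains u where "u \<in> C" "dist z u < e"
proof -
  have "bdd_below (dist z ` C)"
    by (rule bdd_belowI2[of _ 0]) simp
  then have "\<exists>u\<in>C. dist z u < e"
    using assms cINF_less_iff[of C "dist z"] by (simp add: infdist_notempty)
  then show ?thesis
    using that by blast
qed

theorem corollary4p7:
  fixes gs :: "nat \<Rightarrow> complex \<Rightarrow> complex" and g :: "complex \<Rightarrow> complex"
    and \<gamma> \<gamma>' :: "complex set"
  assumes "entire_of_finite_type g"
    and "\<And>n. entire_of_finite_type (gs n)"
    and "\<And>n. card (singular_values (gs n)) = card (singular_values g)"
    and "simple_closed_curve \<gamma>"
    and "\<gamma> \<subseteq> - singular_values g"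
    and "\<gamma>' \<in> components (g -` \<gamma>)"
    and "converges_locally_uniformly gs g"
  shows "covering_space \<gamma>' g \<gamma> \<and>
    (covering_degree \<gamma>' g \<gamma> = \<infinity> \<longleftrightarrow> \<not> bounded \<gamma>') \<and>
    (\<forall>z\<in>\<gamma>'. \<exists>\<epsilon>>0. \<exists>\<Gamma> :: nat \<Rightarrow> complex set.
       (\<forall>\<^sub>F n in sequentially.
          \<Gamma> n \<in> components (gs n -` \<gamma>) \<and> infdist z (\<Gamma> n) < \<epsilon> \<and>
          (\<forall>C \<in> components (gs n -` \<gamma>). infdist z C < \<epsilon> \<longrightarrow> C = \<Gamma> n) \<and>
          covering_space (\<Gamma> n) (gs n) \<gamma>) \<and>
       (covering_degree \<gamma>' g \<gamma> \<noteq> \<infinity> \<longrightarrow>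
          (\<forall>\<^sub>F n in sequentially.
             simple_closed_curve (\<Gamma> n) \<and>
             covering_degree (\<Gamma> n) (gs n) \<gamma> = covering_degree \<gamma>' g \<gamma>) \<and>
          (\<forall>\<epsilon>'>0. \<exists>N. \<forall>n\<ge>N. \<Gamma> n \<subseteq> {w. infdist w \<gamma>' < \<epsilon>'})) \<and>
       (covering_degree \<gamma>' g \<gamma> = \<infinity> \<longrightarrow>
          (\<lambda>n. covering_degree (\<Gamma> n) (gs n) \<gamma>) \<longlonglongrightarrow> \<infinity>))"
proof -
  note conv = assms(7)
  have g: "g holomorphic_on UNIV" "\<not> g constant_on UNIV" "finite (singular_values g)"
    using assms(1) by (auto simp: entire_of_finite_type_def)
  have gs: "gs n holomorphic_on UNIV" "\<not> gs n constant_on UNIV" for n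
    using assms(2)[of n] by (auto simp: entire_of_finite_type_def)
  have cov: "covering_space (g -` \<gamma>) g \<gamma>"
    by (rule covering_space_regular_values[OF g(1,2) assms(5)])
  have "closed \<gamma>"
    using assms(4) closed_path_image simple_path_imp_path unfolding simple_closed_curve_def by blast
  then have "\<forall>\<^sub>F n in sequentially. \<gamma> \<subseteq> - singular_values (gs n)"
    using eventually_avoids_singular_values[OF assms(1-3) conv] assms(5) by blast
  then have cov_n: "\<forall>\<^sub>F n in sequentially. covering_space (gs n -` \<gamma>) (gs n) \<gamma>"
    by eventually_elim (rule covering_space_regular_values[OF gs])
  have sub: "\<gamma>' \<subseteq> g -` \<gamma>"
    using assms(6) in_components_subset by blast
  \<comment> \<open>Parametrizing \<gamma> from \<open>g z\<close> lets the lift start at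
    \<open>z\<close> at time \<open>0\<close>, so \<open>p\<close> depends on
    \<open>z\<close>.\<close>
  have lift: "\<exists>p q. curve_lift p \<gamma> g q \<and> q 0 = z \<and> \<gamma>' = range q" if z: "z \<in> \<gamma>'" for z
  proof -
    have gz: "g z \<in> \<gamma>"
      using z sub by blast
    obtain p where p: "closed_curve_param p \<gamma>" "p 0 = g z"
      using exists_closed_curve_param[OF assms(4) gz] .
    obtain q where q: "curve_lift p \<gamma> g q" "q 0 = z"
      using closed_curve_param.exists_lift[OF p(1) cov p(2)[symmetric]] .
    have "\<gamma>' = range q"
      using components_eq_if_common_point[OF assms(6) curve_lift.range_component[OF q(1)] z] q(2) by blast
    then show ?thesis
      using q by blast
  qed
  \<comment> \<open>The claims about \<gamma>' alone do not involve \<open>z\<close>; a lift through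
    any one point proves them.\<close>
  obtain z0 where "z0 \<in> \<gamma>'"
    using assms(6) in_components_nonempty by blast
  then obtain p0 q0 where q0: "curve_lift p0 \<gamma> g q0" "\<gamma>' = range q0"
    using lift by blast
  have main: "\<exists>\<epsilon>>0. \<exists>\<Gamma> :: nat \<Rightarrow> complex set.
       (\<forall>\<^sub>F n in sequentially.
          \<Gamma> n \<in> components (gs n -` \<gamma>) \<and> infdist z (\<Gamma> n) < \<epsilon> \<and>
          (\<forall>C \<in> components (gs n -` \<gamma>). infdist z C < \<epsilon> \<longrightarrow> C = \<Gamma> n) \<and>
          covering_space (\<Gamma> n) (gs n) \<gamma>) \<and>
       (covering_degree \<gamma>' g \<gamma> \<noteq> \<infinity> \<longrightarrow>
          (\<forall>\<^sub>F n in sequentially.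
             simple_closed_curve (\<Gamma> n) \<and>
             covering_degree (\<Gamma> n) (gs n) \<gamma> = covering_degree \<gamma>' g \<gamma>) \<and>
          (\<forall>\<epsilon>'>0. \<exists>N. \<forall>n\<ge>N. \<Gamma> n \<subseteq> {w. infdist w \<gamma>' < \<epsilon>'})) \<and>
       (covering_degree \<gamma>' g \<gamma> = \<infinity> \<longrightarrow>
          (\<lambda>n. covering_degree (\<Gamma> n) (gs n) \<gamma>) \<longlonglongrightarrow> \<infinity>)" if z: "z \<in> \<gamma>'" for z
  proof -
    obtain p q where q: "curve_lift p \<gamma> g q" "q 0 = z" "\<gamma>' = range q"
      using lift[OF z] by blast
    interpret q: curve_lift p \<gamma> g q by (rule q(1))
    \<comment> \<open>Injectivity is wanted on a neighbourhood open in the plane, not merely in the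
      preimage of \<gamma>, so the covering over all regular values is used.\<close>
    let ?R = "- singular_values g"
    have "open ?R"
      using g(3) by (simp add: finite_imp_closed open_Compl)
    then have op: "open (g -` ?R)"
      using g(1) holomorphic_on_imp_continuous_on by (intro open_vimage) auto
    have "z \<in> g -` ?R"
      using sub z assms(5) by blast
    then obtain V U k where V: "z \<in> V" "openin (top_of_set (g -` ?R)) V" "homeomorphism V U g k"
      using covering_space_local_homeomorphism[OF covering_space_regular_values[OF g(1,2) subset_refl]] by metis
    have "open V"
      using V(2) op openin_open_eq by blast
    moreover have "inj_on g V"
      using V(3) by (metis homeomorphism_apply1 inj_on_inverseI)
    ultimately obtain \<epsilon> \<rho> Q where \<epsilon>: "\<epsilon> > 0" and \<rho>: "\<rho> > 0"
      "\<forall>\<^sub>F n in sequentially. inj_on (gs n) (ball (q 0) \<rho>)"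
      and Q: "\<forall>\<^sub>F n in sequentially. curve_lift p \<gamma> (gs n) (Q n) \<and> dist (q 0) (Q n 0) < \<epsilon> \<and>
         (\<forall>u. gs n u \<in> \<gamma> \<and> dist (q 0) u < \<epsilon> \<longrightarrow> u \<in> range (Q n))"
      and lim: "\<And>T \<eta>. \<eta> > 0 \<Longrightarrow> \<forall>\<^sub>F n in sequentially. \<forall>t\<in>{-T..T}. dist (Q n t) (q t) < \<eta>"
      using approximating_lifts[OF q(1) gs(1) g(1,2) conv cov_n, of V] V(1) q(2) by blast
    \<comment> \<open>Once \<open>Q n\<close> is within half of \<open>dist (q k) (q 0)\<close> of
      \<open>q\<close> at the times \<open>0\<close> and \<open>k\<close>, its two values differ.
      Both the finite and the infinite case rest on this.\<close>
    have distinct: "\<forall>\<^sub>F n in sequentially. \<forall>k\<in>{0<..<d}. Q n (real k) \<noteq> Q n 0"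
      if d: "\<And>k. \<lbrakk>0 < k; k < d\<rbrakk> \<Longrightarrow> q (real k) \<noteq> q 0" for d :: nat
    proof (rule eventually_ball_finite, simp, intro ballI)
      fix k assume "k \<in> {0<..<d}"
      then have pos: "dist (q (real k)) (q 0) / 2 > 0"
        using d by simp
      show "\<forall>\<^sub>F n in sequentially. Q n (real k) \<noteq> Q n 0"
        using lim[OF pos, of "real k"]
      proof eventually_elim
        case (elim n)
        have "dist (Q n (real k)) (q (real k)) < dist (q (real k)) (q 0) / 2"
          "dist (Q n 0) (q 0) < dist (q (real k)) (q 0) / 2"
          using elim by simp_all
        moreover have "dist (q (real k)) (q 0) \<le> dist (Q n (real k)) (q (real k)) + dist (Q n (real k)) (q 0)"
          using dist_triangle3 by blast
        ultimately show ?case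
          by auto
      qed
    qed
    define \<Gamma> where "\<Gamma> n = range (Q n)" for n
    have near: "\<forall>\<^sub>F n in sequentially.
          \<Gamma> n \<in> components (gs n -` \<gamma>) \<and> infdist z (\<Gamma> n) < \<epsilon> \<and>
          (\<forall>C \<in> components (gs n -` \<gamma>). infdist z C < \<epsilon> \<longrightarrow> C = \<Gamma> n) \<and>
          covering_space (\<Gamma> n) (gs n) \<gamma>"
      using Q
    proof eventually_elim
      case (elim n)
      interpret Q: curve_lift p \<gamma> "gs n" "Q n" using elim by simp
      have comp: "\<Gamma> n \<in> components (gs n -` \<gamma>)"
        unfolding \<Gamma>_def by (rule Q.range_component)
      have "infdist z (\<Gamma> n) \<le> dist z (Q n 0)"
        unfolding \<Gamma>_def by (rule infdist_le) simp
      then have "infdist z (\<Gamma> n) < \<epsilon>"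
        using elim q(2) by simp
      moreover have "C = \<Gamma> n" if C: "C \<in> components (gs n -` \<gamma>)" "infdist z C < \<epsilon>" for C
      proof -
        obtain u where u: "u \<in> C" "dist z u < \<epsilon>"
          using infdist_lessE[OF C(2) in_components_nonempty[OF C(1)]] .
        have "gs n u \<in> \<gamma>"
          using in_components_subset[OF C(1)] u(1) by blast
        then have "u \<in> \<Gamma> n"
          using elim u(2) q(2) by (simp add: \<Gamma>_def)
        then show ?thesis
          using components_eq_if_common_point[OF C(1) comp u(1)] by simp
      qed
      moreover have "covering_space (\<Gamma> n) (gs n) \<gamma>"
        unfolding \<Gamma>_def by (rule Q.covering_range)
      ultimately show ?case
        using comp by blast
    qed
    have finite_case: "(\<forall>\<^sub>F n in sequentially. simple_closed_curve (\<Gamma> n) \<and>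
             covering_degree (\<Gamma> n) (gs n) \<gamma> = covering_degree \<gamma>' g \<gamma>) \<and>
          (\<forall>\<epsilon>'>0. \<exists>N. \<forall>n\<ge>N. \<Gamma> n \<subseteq> {w. infdist w \<gamma>' < \<epsilon>'})"
      if fin: "covering_degree \<gamma>' g \<gamma> \<noteq> \<infinity>"
    proof -
      obtain d where d: "d > 0" "q (real d) = q 0" "\<And>k. \<lbrakk>0 < k; k < d\<rbrakk> \<Longrightarrow> q (real k) \<noteq> q 0"
      proof (rule q.exists_period[OF fin[unfolded q(3)]])
        fix d :: nat
        assume "d > 0" "q (real d) = q 0" "\<And>k. \<lbrakk>0 < k; k < d\<rbrakk> \<Longrightarrow> q (real k) \<noteq> q 0"
        then show ?thesis
          by (rule that)
      qed
      \<comment> \<open>\<open>Q n d\<close> and \<open>Q n 0\<close> lie over the same point and in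
        the disc where \<open>gs n\<close> is injective, so approximate closing becomes
        exact.\<close>
      have per: "\<forall>\<^sub>F n in sequentially. curve_lift p \<gamma> (gs n) (Q n) \<and> Q n (real d) = Q n 0"
        using Q \<rho>(2) lim[OF \<rho>(1), of "real d"]
      proof eventually_elim
        case (elim n)
        interpret Q: curve_lift p \<gamma> "gs n" "Q n" using elim(1) by simp
        have "dist (Q n (real d)) (q (real d)) < \<rho>" "dist (Q n 0) (q 0) < \<rho>"
          using elim(3) by simp_all
        then have "Q n (real d) \<in> ball (q 0) \<rho>" "Q n 0 \<in> ball (q 0) \<rho>"
          using d(2) by (simp_all add: dist_commute)
        moreover have "gs n (Q n (real d)) = gs n (Q n 0)"
          using q.p_shift[of 0 "int d"] by (simp add: Q.lift)
        ultimately have "Q n (real d) = Q n 0"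
          using inj_onD[OF elim(2)] by blast
        then show ?case
          using elim(1) by blast
      qed
      have degree: "covering_degree \<gamma>' g \<gamma> = enat d"
        unfolding q(3) using d by (rule q.covering_degree_eq)
      have distinct_d: "\<forall>\<^sub>F n in sequentially. \<forall>k\<in>{0<..<d}. Q n (real k) \<noteq> Q n 0"
        using d(3) by (rule distinct)
      have "\<forall>\<^sub>F n in sequentially. simple_closed_curve (\<Gamma> n) \<and>
             covering_degree (\<Gamma> n) (gs n) \<gamma> = covering_degree \<gamma>' g \<gamma>"
        using per distinct_d
      proof eventually_elim
        case (elim n)
        interpret Q: curve_lift p \<gamma> "gs n" "Q n" using elim(1) by simp
        have dn: "Q n (real d) = Q n 0" "\<And>k. \<lbrakk>0 < k; k < d\<rbrakk> \<Longrightarrow> Q n (real k) \<noteq> Q n 0"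
          using elim by auto
        have "covering_degree (range (Q n)) (gs n) \<gamma> = enat d"
          using d(1) dn by (rule Q.covering_degree_eq)
        moreover have "simple_closed_curve (range (Q n))"
          using d(1) dn by (rule Q.simple_closed_curve_range)
        ultimately show ?case
          unfolding \<Gamma>_def degree by blast
      qed
      moreover have "\<exists>N. \<forall>n\<ge>N. \<Gamma> n \<subseteq> {w. infdist w \<gamma>' < \<epsilon>'}" if "\<epsilon>' > 0" for \<epsilon>'
      proof -
        \<comment> \<open>The period \<open>d\<close> of \<open>Q n\<close> reduces the whole
          component to the times from \<open>0\<close> to \<open>d\<close>, on which
          \<open>Q n\<close> is uniformly close to \<open>q\<close>.\<close>
        have "\<forall>\<^sub>F n in sequentially. \<Gamma> n \<subseteq> {w. infdist w \<gamma>' < \<epsilon>'}"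
          using per lim[OF that, of "real d"]
        proof eventually_elim
          case (elim n)
          interpret Q: curve_lift p \<gamma> "gs n" "Q n" using elim(1) by simp
          show ?case
          proof
            fix w assume "w \<in> \<Gamma> n"
            then obtain t where t: "t \<in> {0..real d}" "w = Q n t"
              unfolding \<Gamma>_def using Q.periodic_range[OF d(1)] elim(1) by auto
            have "infdist w \<gamma>' \<le> dist w (q t)"
              unfolding q(3) by (rule infdist_le) simp
            also have "\<dots> < \<epsilon>'"
              using elim(2) t by simp
            finally show "w \<in> {w. infdist w \<gamma>' < \<epsilon>'}"
              by simp
          qed
        qed
        then show ?thesis
          unfolding eventually_sequentially .
      qed
      ultimately show ?thesis
        by blast
    qed
    have infinite_case: "(\<lambda>n. covering_degree (\<Gamma> n) (gs n) \<gamma>) \<longlonglongrightarrow> \<infinity>"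
      if inf: "covering_degree \<gamma>' g \<gamma> = \<infinity>"
    proof (rule order_tendstoI)
      fix a :: enat assume "a < \<infinity>"
      then obtain m where m: "a = enat m"
        by (cases a) auto
      \<comment> \<open>Excluding the periods up to \<open>m\<close> gives degree at least
        \<open>m + 1\<close>, hence the strict inequality for \<open>a = enat m\<close>.\<close>
      have "\<forall>\<^sub>F n in sequentially. \<forall>k\<in>{0<..<Suc m}. Q n (real k) \<noteq> Q n 0"
        using q.covering_degree_infinite_imp inf unfolding q(3) by (intro distinct) blast
      with Q show "\<forall>\<^sub>F n in sequentially. a < covering_degree (\<Gamma> n) (gs n) \<gamma>"
      proof eventually_elim
        case (elim n)
        interpret Q: curve_lift p \<gamma> "gs n" "Q n" using elim(1) by simp
        have "enat (Suc m) \<le> covering_degree (\<Gamma> n) (gs n) \<gamma>"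
          unfolding \<Gamma>_def by (rule Q.covering_degree_ge) (use elim(2) in simp)
        then show ?case
          by (simp add: m Suc_ile_eq)
      qed
    qed simp
    show ?thesis
      by (rule exI[of _ \<epsilon>], rule conjI[OF \<epsilon>], rule exI[of _ \<Gamma>],
          rule conjI[OF near conjI[OF impI[OF finite_case] impI[OF infinite_case]]])
  qed
  show ?thesis
    using curve_lift.covering_range[OF q0(1)] curve_lift.covering_degree_infinite_iff[OF q0(1) g(1,2)] main
    unfolding q0(2)[symmetric] by blast
qed

end
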